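(* Assume the Riemann Hypothesis. Let $a,b,c,k$ be positive integers with $\gcd(a,b,c)=1$ and $a<c<b<2c$. Let $\alpha_k(a;c)<\frac1b$ be a real number such that $\Delta_k(a;c;x)\ll x^{\alpha_k(a;c)+\varepsilon}$ for every $\varepsilon>0$. Then for every $\varepsilon>0$ and $x\ge 2$, $$\Delta_k(a,b;c;x)\ll x^{\frac{1}{a+b-ab\,\alpha_k(a;c)}+\varepsilon}.$$
   Context: $\zeta$ is the Riemann zeta-function and $\mu_k$ is defined by $\sum_{n\ge1}\mu_k(n)n^{-s}=\zeta(s)^{-k}$ for $\Re s>1$. Put $u_k(a;c;n)=\sum_{l^ad^c=n}\mu_k(d)$ (sum over positive integers $l,d$), and $$\Delta_k(a;c;x)=\sum_{n\le x}u_k(a;c;n)-\frac{x^{1/a}}{\zeta^k(c/a)}.$$ The arithmetic function $f_k(a,b;c;n)$ is defined by $\sum_{n\ge1} f_k(a,b;c;n)n^{-s}=\zeta(as)\zeta(bs)/\zeta^k(cs)$ for $\Re s>1$, and $\Delta_k(a,b;c;x)$ is defined (for $a\ne b$) by $$\sum_{n\le x}f_k(a,b;c;n)=\frac{\zeta(b/a)}{\zeta^k(c/a)}x^{1/a}+\frac{\zeta(a/b)}{\zeta^k(c/b)}x^{1/b}+\Delta_k(a,b;c;x).$$ Implied constants depend only on $a,b,c,k,\alpha_k(a;c),\varepsilon$. *)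

theory Defs
  imports "HOL-Complex_Analysis.Complex_Analysis" "HOL-Computational_Algebra.Computational_Algebra"
begin

section \<open>The Riemann zeta function\<close>

text \<open>
  The meromorphic continuation of the Dirichlet series to the whole plane. The point 1 is its pole;
  the value there is fixed to 0 only to make the function unique (see
  \<open>is_zeta_unique\<close> and \<open>is_zeta_zeta\<close> below).
\<close>

definition is_zeta :: "(complex \<Rightarrow> complex) \<Rightarrow> bool" where
  "is_zeta f \<longleftrightarrow> f holomorphic_on (- {1}) \<and> f 1 = 0 \<and>
     (\<forall>s. Re s > 1 \<longrightarrow> (\<lambda>n. 1 / of_nat (Suc n) powr s) sums f s)"

definition zeta :: "complex \<Rightarrow> complex" where
  "zeta = (THE f. is_zeta f)"

text \<open>The zeros in the open critical strip are the nontrivial ones.\<close>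

definition riemann_hypothesis :: bool where
  "riemann_hypothesis \<longleftrightarrow> (\<forall>s. zeta s = 0 \<and> 0 < Re s \<and> Re s < 1 \<longrightarrow> Re s = 1 / 2)"

section \<open>The arithmetic functions and error terms\<close>

text \<open>
  An arithmetic function is given by its values at the positive integers; the value at 0 is fixed
  to 0 so that the coefficients are unique (see \<open>dirichlet_coeffs_unique\<close>;
  existence for the two series used is \<open>mu_k_coeffs\<close> and \<open>f_k_coeffs\<close>).
\<close>

definition is_dirichlet_coeffs :: "(nat \<Rightarrow> complex) \<Rightarrow> (complex \<Rightarrow> complex) \<Rightarrow> bool" where
  "is_dirichlet_coeffs g F \<longleftrightarrow> g 0 = 0 \<and>
     (\<forall>s. Re s > 1 \<longrightarrow> (\<lambda>n. g (Suc n) / of_nat (Suc n) powr s) sums F s)"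

definition dirichlet_coeffs :: "(complex \<Rightarrow> complex) \<Rightarrow> nat \<Rightarrow> complex" where
  "dirichlet_coeffs F = (THE g. is_dirichlet_coeffs g F)"

definition mu_k :: "nat \<Rightarrow> nat \<Rightarrow> complex" where
  "mu_k k = dirichlet_coeffs (\<lambda>s. 1 / zeta s ^ k)"

text \<open>For positive \<open>a\<close> and \<open>c\<close> the index set is finite (\<open>finite_u_k_index\<close>).\<close>

definition u_k :: "nat \<Rightarrow> nat \<Rightarrow> nat \<Rightarrow> nat \<Rightarrow> complex" where
  "u_k k a c n = (\<Sum>(l, d) \<in> {(l, d). 0 < l \<and> 0 < d \<and> l ^ a * d ^ c = n}. mu_k k d)"

definition f_k :: "nat \<Rightarrow> nat \<Rightarrow> nat \<Rightarrow> nat \<Rightarrow> nat \<Rightarrow> complex" where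
  "f_k k a b c =
     dirichlet_coeffs (\<lambda>s. zeta (of_nat a * s) * zeta (of_nat b * s) / zeta (of_nat c * s) ^ k)"

definition Delta_u :: "nat \<Rightarrow> nat \<Rightarrow> nat \<Rightarrow> real \<Rightarrow> complex" where
  "Delta_u k a c x =
     (\<Sum>n\<in>{1..nat \<lfloor>x\<rfloor>}. u_k k a c n)
     - of_real (x powr (1 / real a)) / zeta (of_nat c / of_nat a) ^ k"

definition Delta_f :: "nat \<Rightarrow> nat \<Rightarrow> nat \<Rightarrow> nat \<Rightarrow> real \<Rightarrow> complex" where
  "Delta_f k a b c x =
     (\<Sum>n\<in>{1..nat \<lfloor>x\<rfloor>}. f_k k a b c n)
     - (zeta (of_nat b / of_nat a) / zeta (of_nat c / of_nat a) ^ k * of_real (x powr (1 / real a))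
        + zeta (of_nat a / of_nat b) / zeta (of_nat c / of_nat b) ^ k * of_real (x powr (1 / real b)))"

section \<open>Existence and uniqueness of the zeta function\<close>

lemma powr_taylor_bound:
  fixes z :: complex and t R :: real
  assumes z: "norm z \<le> R" and t: "0 \<le> t" "t \<le> 1"
  shows "norm ((1 + of_real t) powr z - (\<Sum>j\<le>M. (z gchoose j) * of_real t ^ j))
    \<le> (R + real (Suc M)) ^ Suc M * 2 powr (R + real (Suc M)) * t ^ Suc M"
proof -
  define S :: "complex set" where "S = closed_segment 0 1"
  define f :: "nat \<Rightarrow> complex \<Rightarrow> complex"
    where "f = (\<lambda>i x. (\<Prod>m=0..<i. z - of_nat m) * (1 + x) powr (z - of_nat i))"
  define B where "B = (R + real (Suc M)) ^ Suc M * 2 powr (R + real (Suc M))"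
  have R: "R \<ge> 0" using z norm_ge_zero[of z] by linarith
  have S: "\<exists>u. x = of_real u \<and> 0 \<le> u \<and> u \<le> 1" if "x \<in> S" for x
    using that by (auto simp: S_def in_segment scaleR_conv_of_real)
  have d: "(f i has_field_derivative f (Suc i) x) (at x within S)" if "x \<in> S" for i x
  proof -
    from S[OF that] obtain u where u: "x = of_real u" "0 \<le> u" "u \<le> 1" by blast
    have nz: "1 + x \<notin> \<real>\<^sub>\<le>\<^sub>0"
      using u by (auto simp: complex_nonpos_Reals_iff)
    have "((\<lambda>x. (1 + x) powr (z - of_nat i)) has_field_derivative
            (z - of_nat i) * (1 + x) powr (z - of_nat i - 1) * 1) (at x within S)"
      by (rule DERIV_chain2[where f = "\<lambda>y. y powr (z - of_nat i)" and g = "\<lambda>x. 1 + x"])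
         (use has_field_derivative_powr[OF nz, of "z - of_nat i"] in \<open>auto intro!: derivative_eq_intros\<close>)
    from DERIV_cmult[OF this, of "\<Prod>m=0..<i. z - of_nat m"] show ?thesis
      unfolding f_def by (simp add: algebra_simps)
  qed
  have b: "cmod (f (Suc M) x) \<le> B" if "x \<in> S" for x
  proof -
    from S[OF that] obtain u where u: "x = of_real u" "0 \<le> u" "u \<le> 1" by blast
    have "norm (\<Prod>m=0..<Suc M. z - of_nat m) = (\<Prod>m=0..<Suc M. norm (z - of_nat m))"
      by (simp add: prod_norm[symmetric] norm_mult)
    also have "\<dots> \<le> (\<Prod>m=0..<Suc M. R + real (Suc M))"
    proof (intro prod_mono conjI)
      fix m assume m: "m \<in> {0..<Suc M}"
      have "norm (z - of_nat m) \<le> norm z + norm (of_nat m :: complex)" by (rule norm_triangle_ineq4)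
      also have "\<dots> \<le> R + real (Suc M)" using z m by simp
      finally show "norm (z - of_nat m) \<le> R + real (Suc M)" .
    qed auto
    also have "\<dots> = (R + real (Suc M)) ^ Suc M" by simp
    finally have 1: "norm (\<Prod>m=0..<Suc M. z - of_nat m) \<le> (R + real (Suc M)) ^ Suc M" .
    have "norm ((1 + x) powr (z - of_nat (Suc M))) = (1 + u) powr (Re z - real (Suc M))"
      using u norm_powr_real_powr[of "of_real (1+u)" "z - of_nat (Suc M)"] by simp
    also have "\<dots> \<le> (1 + u) powr (R + real (Suc M))"
      using u z complex_Re_le_cmod[of z] by (intro powr_mono) auto
    also have "\<dots> \<le> 2 powr (R + real (Suc M))"
      using u R by (intro powr_mono2) auto
    finally have 2: "norm ((1 + x) powr (z - of_nat (Suc M))) \<le> 2 powr (R + real (Suc M))" .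
    show ?thesis unfolding f_def B_def norm_mult
      by (intro mult_mono 1 2) (use R in auto)
  qed
  have "cmod (f 0 (of_real t) - (\<Sum>i\<le>M. f i 0 * (of_real t - 0) ^ i / fact i))
     \<le> B * cmod (of_real t - 0) ^ Suc M / fact M"
    by (rule complex_Taylor[of S M f B]) (use t d b in \<open>auto simp: S_def in_segment scaleR_conv_of_real\<close>)
  also have "(\<Sum>i\<le>M. f i 0 * (of_real t - 0) ^ i / fact i) = (\<Sum>j\<le>M. (z gchoose j) * of_real t ^ j)"
    by (intro sum.cong) (auto simp: f_def gbinomial_prod_rev)
  also have "B * cmod (of_real t - 0) ^ Suc M / fact M \<le> B * cmod (of_real t - 0) ^ Suc M"
  proof -
    have "B * cmod (of_real t - 0) ^ Suc M \<ge> 0" using R by (simp add: B_def)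
    thus ?thesis using fact_ge_1[of M, where 'a = real]
      by (metis div_by_1 divide_left_mono mult_pos_pos zero_less_one less_le_trans mult_1)
  qed
  finally show ?thesis using t by (simp add: f_def B_def)
qed

lemma holomorphic_on_series:
  fixes f :: "nat \<Rightarrow> complex \<Rightarrow> complex"
  assumes "open S" "\<And>n. f n holomorphic_on S"
    and "\<And>x. x \<in> S \<Longrightarrow> \<exists>d M. 0 < d \<and> cball x d \<subseteq> S \<and> summable M \<and> (\<forall>n. \<forall>y\<in>cball x d. norm (f n y) \<le> M n)"
  shows "(\<lambda>x. \<Sum>n. f n x) holomorphic_on S" "\<And>x. x \<in> S \<Longrightarrow> summable (\<lambda>n. f n x)"
proof -
  show "(\<lambda>x. \<Sum>n. f n x) holomorphic_on S"
  proof (rule holomorphic_uniform_sequence[where f = "\<lambda>n x. \<Sum>i<n. f i x"])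
    fix x assume "x \<in> S"
    from assms(3)[OF this] obtain d M where dM: "0 < d" "cball x d \<subseteq> S" "summable M"
      "\<forall>n. \<forall>y\<in>cball x d. norm (f n y) \<le> M n" by blast
    show "\<exists>d>0. cball x d \<subseteq> S \<and>
       uniform_limit (cball x d) (\<lambda>n x. \<Sum>i<n. f i x) (\<lambda>x. \<Sum>n. f n x) sequentially"
      using dM by (intro exI[of _ d] conjI Weierstrass_m_test[of _ _ M]) auto
  qed (use assms in \<open>auto intro!: holomorphic_intros\<close>)
  fix x assume "x \<in> S"
  from assms(3)[OF this] obtain d M where dM: "0 < d" "summable M"
      "\<forall>n. \<forall>y\<in>cball x d. norm (f n y) \<le> M n" by blast
  hence "norm (f n x) \<le> M n" for n by auto
  thus "summable (\<lambda>n. f n x)" using dM(2) by (rule summable_comparison_test'[where N = 0, rotated])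
qed

text \<open>
  The continuation proceeds one unit strip at a time: summing the Taylor remainders of
  \<open>(n + 1) powr (1 - s)\<close> around \<open>n\<close> expresses \<open>(s - 1) * zeta s\<close> by its values at
  \<open>s + 1, s + 2, \<dots>\<close> and a series that converges further to the left.
\<close>

definition zeta_rem :: "nat \<Rightarrow> nat \<Rightarrow> complex \<Rightarrow> complex" where
  "zeta_rem M n s = of_nat (Suc (Suc n)) powr (1 - s) - of_nat (Suc n) powr (1 - s)
     - (\<Sum>j\<in>{1..M}. ((1 - s) gchoose j) * of_nat (Suc n) powr (1 - s - of_nat j))"

lemma zeta_rem_bound:
  assumes "norm (1 - s) \<le> R"
  shows "norm (zeta_rem M n s) \<le> (R + real (Suc M)) ^ Suc M * 2 powr (R + real (Suc M))
            * real (Suc n) powr (- Re s - real M)"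
proof -
  define N where "N = real (Suc n)"
  define z where "z = 1 - s"
  have N: "N \<ge> 1" by (simp add: N_def)
  have 1: "of_nat (Suc (Suc n)) powr z = of_nat (Suc n) powr z * (1 + of_real (1 / N)) powr z"
  proof -
    have "of_nat (Suc (Suc n)) = complex_of_real (N * (1 + 1 / N))"
    proof -
      have "N * (1 + 1 / N) = N + 1" using N by (simp add: field_simps)
      thus ?thesis by (simp add: N_def)
    qed
    also have "\<dots> powr z = of_real N powr z * of_real (1 + 1 / N) powr z"
      unfolding of_real_mult using N by (intro powr_times_real) auto
    finally show ?thesis by (simp add: N_def)
  qed
  have 2: "of_nat (Suc n) powr (z - of_nat j) = of_nat (Suc n) powr z * of_real (1 / N) ^ j" for j
    by (simp add: powr_diff N_def powr_nat' power_one_over field_simps del: of_nat_Suc)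
  have "zeta_rem M n s = of_nat (Suc n) powr z *
     ((1 + of_real (1 / N)) powr z - 1 - (\<Sum>j\<in>{1..M}. (z gchoose j) * of_real (1 / N) ^ j))"
    unfolding zeta_rem_def z_def[symmetric] 1 2
    by (simp add: algebra_simps sum_distrib_left del: of_nat_Suc)
  also have "(1 + of_real (1 / N)) powr z - 1 - (\<Sum>j\<in>{1..M}. (z gchoose j) * of_real (1 / N) ^ j)
    = (1 + of_real (1 / N)) powr z - (\<Sum>j\<le>M. (z gchoose j) * of_real (1 / N) ^ j)"
    by (simp add: atMost_atLeast0 sum.atLeast_Suc_atMost)
  finally have eq: "zeta_rem M n s = of_nat (Suc n) powr z *
     ((1 + of_real (1 / N)) powr z - (\<Sum>j\<le>M. (z gchoose j) * of_real (1 / N) ^ j))" .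
  define B where "B = (R + real (Suc M)) ^ Suc M * 2 powr (R + real (Suc M))"
  have "norm (zeta_rem M n s) \<le> norm ((of_nat (Suc n) :: complex) powr z) * (B * (1 / N) ^ Suc M)"
    unfolding eq norm_mult B_def
    by (intro mult_left_mono powr_taylor_bound) (use assms N in \<open>auto simp: z_def\<close>)
  also have "norm ((of_nat (Suc n) :: complex) powr z) = N powr Re z"
    using norm_powr_real_powr[of "of_nat (Suc n)" z] by (simp add: N_def del: of_nat_Suc)
  also have "(1 / N) ^ Suc M = N powr (- real (Suc M))"
    using N by (simp add: powr_minus powr_realpow power_one_over field_simps del: of_nat_Suc power_Suc)
  also have "N powr Re z * (B * N powr (- real (Suc M))) = B * N powr (Re z + - real (Suc M))"
    by (subst powr_add) simp
  finally show ?thesis by (simp add: z_def B_def N_def algebra_simps)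
qed

lemma summable_Suc_powr: "e < -1 \<Longrightarrow> summable (\<lambda>n. real (Suc n) powr e)"
  using summable_real_powr_iff[of e] summable_Suc_iff[of "\<lambda>n. real n powr e"] by simp

lemma zeta_rem_sum:
  defines "S \<equiv> \<lambda>M. {s. Re s > 1 - real M}"
  shows "(\<lambda>s. \<Sum>n. zeta_rem M n s) holomorphic_on S M"
    and "s \<in> S M \<Longrightarrow> summable (\<lambda>n. zeta_rem M n s)"
proof -
  have op: "open (S M)" unfolding S_def by (rule open_halfspace_Re_gt)
  have hol: "zeta_rem M n holomorphic_on S M" for n
    unfolding zeta_rem_def[abs_def] gbinomial_prod_rev
    by (intro holomorphic_intros) (auto simp del: of_nat_Suc)
  have *: "\<exists>d B. 0 < d \<and> cball s d \<subseteq> S M \<and> summable B \<and> (\<forall>n. \<forall>y\<in>cball s d. norm (zeta_rem M n y) \<le> B n)"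
    if s: "s \<in> S M" for s
  proof -
    define d where "d = (Re s - (1 - real M)) / 2"
    define R where "R = norm (1 - s) + d"
    define C where "C = (R + real (Suc M)) ^ Suc M * 2 powr (R + real (Suc M))"
    have d: "d > 0" using s by (simp add: d_def S_def)
    have y: "Re y \<ge> 1 - real M + d" "norm (1 - y) \<le> R" if "y \<in> cball s d" for y
    proof -
      have "Re s - Re y \<le> norm (s - y)" using complex_Re_le_cmod[of "s - y"] by simp
      also have "\<dots> \<le> d" using that by (simp add: dist_norm)
      finally show "Re y \<ge> 1 - real M + d" by (simp add: d_def field_simps)
      have "norm (1 - y) \<le> norm (1 - s) + norm (s - y)" using norm_triangle_ineq[of "1 - s" "s - y"] by simp
      thus "norm (1 - y) \<le> R" using that by (simp add: R_def dist_norm)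
    qed
    have R: "R \<ge> 0" using d by (simp add: R_def)
    show ?thesis
    proof (intro exI[of _ d] exI[of _ "\<lambda>n. C * real (Suc n) powr (-1 - d)"] conjI allI ballI)
      show "cball s d \<subseteq> S M" using y(1) d by (force simp: S_def)
      show "summable (\<lambda>n. C * real (Suc n) powr (- 1 - d))"
        using d by (intro summable_mult summable_Suc_powr) auto
      fix n y assume "y \<in> cball s d"
      from y[OF this] have "norm (zeta_rem M n y) \<le> C * real (Suc n) powr (- Re y - real M)"
        unfolding C_def by (intro zeta_rem_bound)
      also have "\<dots> \<le> C * real (Suc n) powr (- 1 - d)"
        using y(1)[OF \<open>y \<in> cball s d\<close>] R unfolding C_def
        by (intro mult_left_mono powr_mono) auto
      finally show "norm (zeta_rem M n y) \<le> C * real (Suc n) powr (- 1 - d)" .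
    qed (fact d)
  qed
  show "(\<lambda>s. \<Sum>n. zeta_rem M n s) holomorphic_on S M"
    by (rule holomorphic_on_series[OF op hol *])
  show "s \<in> S M \<Longrightarrow> summable (\<lambda>n. zeta_rem M n s)"
    by (rule holomorphic_on_series(2)[OF op hol *])
qed

definition zeta_series :: "complex \<Rightarrow> complex" where
  "zeta_series s = (\<Sum>n. 1 / of_nat (Suc n) powr s)"

lemma norm_Suc_powr: "norm (of_nat (Suc n) powr s :: complex) = real (Suc n) powr Re s"
  using norm_powr_real_powr[of "of_nat (Suc n)" s] by (simp del: of_nat_Suc)

lemma zeta_series_sums: "Re s > 1 \<Longrightarrow> (\<lambda>n. 1 / of_nat (Suc n) powr s) sums zeta_series s"
proof -
  assume "Re s > 1"
  hence "summable (\<lambda>n. real (Suc n) powr - Re s)" by (intro summable_Suc_powr) auto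
  hence "summable (\<lambda>n. norm (1 / of_nat (Suc n) powr s :: complex))"
    by (simp add: norm_divide norm_Suc_powr powr_minus_divide del: of_nat_Suc)
  thus ?thesis unfolding zeta_series_def by (rule summable_sums[OF summable_norm_cancel])
qed

lemma zeta_series_holomorphic: "zeta_series holomorphic_on {s. Re s > 1}"
  unfolding zeta_series_def[abs_def]
proof (rule holomorphic_on_series)
  show "open {s. Re s > 1}" by (rule open_halfspace_Re_gt)
  show "(\<lambda>s. 1 / of_nat (Suc n) powr s) holomorphic_on {s. Re s > 1}" for n
    by (intro holomorphic_intros) (auto simp del: of_nat_Suc)
  fix s assume s: "s \<in> {s. Re s > 1}"
  define d where "d = (Re s - 1) / 2"
  have d: "d > 0" using s by (simp add: d_def)
  have y: "Re y \<ge> 1 + d" if "y \<in> cball s d" for y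
  proof -
    have "Re s - Re y \<le> norm (s - y)" using complex_Re_le_cmod[of "s - y"] by simp
    also have "\<dots> \<le> d" using that by (simp add: dist_norm)
    finally show "Re y \<ge> 1 + d" by (simp add: d_def field_simps)
  qed
  show "\<exists>d M. 0 < d \<and> cball s d \<subseteq> {s. Re s > 1} \<and> summable M \<and>
      (\<forall>n. \<forall>y\<in>cball s d. norm (1 / of_nat (Suc n) powr y :: complex) \<le> M n)"
  proof (intro exI[of _ d] exI[of _ "\<lambda>n. real (Suc n) powr (- (1 + d))"] conjI allI ballI)
    show "cball s d \<subseteq> {s. Re s > 1}" using y d by force
    show "summable (\<lambda>n. real (Suc n) powr - (1 + d))" using d by (intro summable_Suc_powr) auto
    fix n y assume "y \<in> cball s d"
    have "norm (1 / of_nat (Suc n) powr y :: complex) = real (Suc n) powr - Re y"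
      by (simp add: norm_divide norm_Suc_powr powr_minus_divide del: of_nat_Suc)
    also have "\<dots> \<le> real (Suc n) powr - (1 + d)"
      using y[OF \<open>y \<in> cball s d\<close>] by (intro powr_mono) auto
    finally show "norm (1 / of_nat (Suc n) powr y :: complex) \<le> real (Suc n) powr - (1 + d)" .
  qed (fact d)
qed

lemma zeta_series_rec:
  assumes s: "Re s > 1"
  shows "(s - 1) * zeta_series s = 1 + (\<Sum>n. zeta_rem (Suc m) n s)
     - (\<Sum>j\<in>{2..Suc m}. ((1 - s) gchoose (j - 1)) / of_nat j * ((s + of_nat j - 2) * zeta_series (s + of_nat j - 1)))"
proof -
  define R where "R = (\<Sum>n. zeta_rem (Suc m) n s)"
  define T where "T = (\<Sum>j\<in>{2..Suc m}. ((1 - s) gchoose (j - 1)) / of_nat j * ((s + of_nat j - 2) * zeta_series (s + of_nat j - 1)))"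
  have lim: "(\<lambda>n. of_nat (Suc n) powr (1 - s)) \<longlonglongrightarrow> (0 :: complex)"
  proof (rule tendsto_norm_zero_cancel)
    have "(\<lambda>n. real n powr (1 - Re s)) \<longlonglongrightarrow> 0"
      using s by (intro tendsto_neg_powr filterlim_real_sequentially) auto
    from LIMSEQ_Suc[OF this]
    show "(\<lambda>n. norm (of_nat (Suc n) powr (1 - s) :: complex)) \<longlonglongrightarrow> 0"
      by (simp add: norm_Suc_powr del: of_nat_Suc)
  qed
  have "(\<lambda>n. of_nat (Suc (Suc n)) powr (1 - s) - of_nat (Suc n) powr (1 - s)) sums (0 - of_nat (Suc 0) powr (1 - s) :: complex)"
    by (rule telescope_sums[OF lim])
  moreover have "(\<lambda>n. \<Sum>j\<in>{1..Suc m}. ((1 - s) gchoose j) * of_nat (Suc n) powr (1 - s - of_nat j)) sums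
     (\<Sum>j\<in>{1..Suc m}. ((1 - s) gchoose j) * zeta_series (s + of_nat j - 1))"
  proof (intro sums_sum sums_mult)
    fix j assume j: "j \<in> {1..Suc m}"
    hence "Re (s + of_nat j - 1) > 1" using s by simp
    from zeta_series_sums[OF this]
    show "(\<lambda>n. of_nat (Suc n) powr (1 - s - of_nat j)) sums zeta_series (s + of_nat j - 1)"
      by (simp add: powr_minus_divide[symmetric] algebra_simps del: of_nat_Suc)
  qed
  ultimately have "(\<lambda>n. zeta_rem (Suc m) n s) sums (0 - of_nat (Suc 0) powr (1 - s) -
     (\<Sum>j\<in>{1..Suc m}. ((1 - s) gchoose j) * zeta_series (s + of_nat j - 1)))"
    unfolding zeta_rem_def by (rule sums_diff)
  hence "(\<Sum>n. zeta_rem (Suc m) n s) = - 1 - (\<Sum>j\<in>{1..Suc m}. ((1 - s) gchoose j) * zeta_series (s + of_nat j - 1))"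
    by (simp add: sums_iff)
  also have "{1..Suc m} = insert 1 {2..Suc m}" by auto
  also have "(\<Sum>j\<in>\<dots>. ((1 - s) gchoose j) * zeta_series (s + of_nat j - 1)) =
     (1 - s) * zeta_series s + (\<Sum>j\<in>{2..Suc m}. ((1 - s) gchoose j) * zeta_series (s + of_nat j - 1))"
    by (subst sum.insert) auto
  also have "(\<Sum>j\<in>{2..Suc m}. ((1 - s) gchoose j) * zeta_series (s + of_nat j - 1)) =
    (\<Sum>j\<in>{2..Suc m}. - (((1 - s) gchoose (j - 1)) / of_nat j * ((s + of_nat j - 2) * zeta_series (s + of_nat j - 1))))"
  proof (rule sum.cong)
    fix j assume "j \<in> {2..Suc m}"
    then obtain i where j: "j = Suc i" by (cases j) auto
    have "((1 - s) gchoose Suc i) = ((1 - s) gchoose i) * (1 - s - of_nat i) / of_nat (Suc i)"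
      by (simp add: gbinomial_prod_rev field_simps)
    moreover have "1 - s - of_nat i = - (s + of_nat j - 2)" by (simp add: j)
    ultimately have *: "((1 - s) gchoose j) = - (((1 - s) gchoose (j - 1)) / of_nat j * (s + of_nat j - 2))"
      by (simp only: j diff_Suc_1 mult_minus_right minus_divide_left[symmetric] times_divide_eq_left)
    show "((1 - s) gchoose j) * zeta_series (s + of_nat j - 1) =
       - (((1 - s) gchoose (j - 1)) / of_nat j * ((s + of_nat j - 2) * zeta_series (s + of_nat j - 1)))"
      by (simp only: * mult_minus_left mult.assoc)
  qed simp
  also have "\<dots> = - T" unfolding T_def by (rule sum_negf)
  finally have "R = - 1 - ((1 - s) * zeta_series s + - T)" unfolding R_def .
  thus ?thesis unfolding R_def[symmetric] T_def[symmetric] by (simp add: ring_distribs)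
qed

lemma zeta_continuation_halfplane:
  "\<exists>G. G holomorphic_on {s. Re s > 1 - real m} \<and> (\<forall>s. Re s > 1 \<longrightarrow> G s = (s - 1) * zeta_series s)"
proof (induction m)
  case 0
  show ?case
    by (rule exI[of _ "\<lambda>s. (s - 1) * zeta_series s"])
       (auto intro!: holomorphic_intros zeta_series_holomorphic)
next
  case (Suc m)
  then obtain G where G: "G holomorphic_on {s. Re s > 1 - real m}"
    "\<And>s. Re s > 1 \<Longrightarrow> G s = (s - 1) * zeta_series s" by blast
  define G' where "G' = (\<lambda>s. 1 + (\<Sum>n. zeta_rem (Suc m) n s)
     - (\<Sum>j\<in>{2..Suc m}. ((1 - s) gchoose (j - 1)) / of_nat j * G (s + of_nat j - 1)))"
  have "(\<lambda>s. G (s + of_nat j - 1)) holomorphic_on {s. Re s > 1 - real (Suc m)}" if "j \<ge> 2" for j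
  proof -
    have "(G \<circ> (\<lambda>s. s + of_nat j - 1)) holomorphic_on {s. Re s > 1 - real (Suc m)}"
      by (rule holomorphic_on_compose_gen[OF _ G(1)]) (use that in \<open>auto intro!: holomorphic_intros\<close>)
    thus ?thesis by (simp add: o_def)
  qed
  moreover have "(\<lambda>s. (1 - s) gchoose i) holomorphic_on A" for i A
    unfolding gbinomial_prod_rev by (intro holomorphic_intros) auto
  ultimately have "G' holomorphic_on {s. Re s > 1 - real (Suc m)}"
    unfolding G'_def by (intro holomorphic_intros zeta_rem_sum(1)) auto
  moreover have "G' s = (s - 1) * zeta_series s" if s: "Re s > 1" for s
  proof -
    have "G (s + of_nat j - 1) = (s + of_nat j - 2) * zeta_series (s + of_nat j - 1)"
      if "j \<in> {2..Suc m}" for j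
      using G(2)[of "s + of_nat j - 1"] s that by simp
    thus ?thesis unfolding zeta_series_rec[OF s, of m] G'_def by (auto intro!: sum.cong)
  qed
  ultimately show ?case by blast
qed

lemma is_zeta_exists: "\<exists>f. is_zeta f"
proof -
  define H where "H = (\<lambda>m. {s. Re s > 1 - real m})"
  obtain G where G: "\<And>m. G m holomorphic_on H m"
    "\<And>m s. Re s > 1 \<Longrightarrow> G m s = (s - 1) * zeta_series s"
    using zeta_continuation_halfplane unfolding H_def by metis
  have op: "open (H m)" "convex (H m)" for m
    unfolding H_def by (auto intro: open_halfspace_Re_gt convex_halfspace_Re_gt)
  have eq: "G m s = G n s" if "s \<in> H m" "m \<le> n" for m n s
  proof (rule analytic_continuation_open[where f = "G m" and g = "G n"])
    show "open {s. Re s > 1}" by (rule open_halfspace_Re_gt)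
    have "2 \<in> {s. Re s > 1}" by simp
    thus "{s. Re s > 1} \<noteq> {}" by blast
    show "connected (H m)" using op by (intro convex_connected)
    show "{s. Re s > 1} \<subseteq> H m" by (auto simp: H_def)
    have "H m \<subseteq> H n" using that by (auto simp: H_def)
    thus "G n holomorphic_on H m" using G(1) holomorphic_on_subset by blast
  qed (use that op G in auto)
  define K where "K = (\<lambda>s. G (nat (\<lceil>1 - Re s\<rceil> + 1)) s)"
  have K: "K s = G m s" if "s \<in> H m" for m s
  proof -
    have "s \<in> H (nat (\<lceil>1 - Re s\<rceil> + 1))" unfolding H_def by simp linarith
    thus ?thesis unfolding K_def using eq that by (metis nat_le_linear)
  qed
  have "K holomorphic_on UNIV"
  proof -
    have "K holomorphic_on (\<Union>m. H m)"
    proof (rule holomorphic_on_UN_open)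
      show "K holomorphic_on H m" for m using G(1) K holomorphic_cong by metis
    qed (use op in auto)
    also have "(\<Union>m. H m) = UNIV"
    proof -
      have "s \<in> H (nat (\<lceil>1 - Re s\<rceil> + 1))" for s unfolding H_def by simp linarith
      thus ?thesis by blast
    qed
    finally show ?thesis .
  qed
  hence "(\<lambda>s. K s / (s - 1)) holomorphic_on - {1}"
    by (intro holomorphic_intros) (auto intro: holomorphic_on_subset)
  moreover have "(\<lambda>n. 1 / of_nat (Suc n) powr s) sums (K s / (s - 1))" if "Re s > 1" for s
  proof -
    have "K s = (s - 1) * zeta_series s" using that K[of s 0] G(2)[of s 0] by (simp add: H_def)
    moreover have "s \<noteq> 1" using that by auto
    ultimately show ?thesis using zeta_series_sums[OF that] by simp
  qed
  ultimately have "is_zeta (\<lambda>s. K s / (s - 1))" by (simp add: is_zeta_def)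
  thus ?thesis by blast
qed

lemma is_zeta_unique:
  assumes "is_zeta f" "is_zeta g"
  shows "f = g"
proof
  fix s
  show "f s = g s"
  proof (cases "s = 1")
    case False
    show ?thesis
    proof (rule analytic_continuation_open[where f = f and g = g])
      show "open {s. Re s > 1}" by (rule open_halfspace_Re_gt)
      have "2 \<in> {s. Re s > 1}" by simp
      thus "{s. Re s > 1} \<noteq> {}" by blast
      show "connected (- {1 :: complex})" by (intro connected_punctured_universe) simp
      show "f z = g z" if "z \<in> {s. Re s > 1}" for z
        using assms that by (auto simp: is_zeta_def intro: sums_unique2)
    qed (use assms False in \<open>auto simp: is_zeta_def\<close>)
  qed (use assms in \<open>simp add: is_zeta_def\<close>)
qed

lemma is_zeta_zeta: "is_zeta zeta"
  unfolding zeta_def using is_zeta_exists is_zeta_unique by (metis theI)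

section \<open>Existence and uniqueness of the Dirichlet coefficients\<close>

lemma vanishing_coeffs:
  fixes e :: "nat \<Rightarrow> complex"
  assumes sums: "\<And>t::nat. (\<lambda>n. e n / of_nat (Suc n) ^ (t + 2)) sums 0"
  shows "e K = 0"
proof (induction K rule: less_induct)
  case (less K)
  have "(\<lambda>n. e n / of_nat (Suc n) ^ 2) \<longlonglongrightarrow> 0"
    using summable_LIMSEQ_zero[OF sums_summable[OF sums[of 0]]] by (simp only: add_0)
  hence "Bseq (\<lambda>n. e n / of_nat (Suc n) ^ 2)" by (intro convergent_imp_Bseq) (auto simp: convergent_def)
  then obtain C where C: "C > 0" "\<And>n. norm (e n / of_nat (Suc n) ^ 2) \<le> C"
    by (auto simp: Bseq_def)
  have e: "norm (e n) \<le> C * real (Suc n) ^ 2" for n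
    using C(2)[of n] by (simp add: norm_divide norm_power field_simps del: of_nat_Suc)
  define W where "W = (\<Sum>n. 1 / real (n + K + 2) ^ 2)"
  have W: "summable (\<lambda>n. 1 / real (n + K + 2) ^ 2)"
    using summable_ignore_initial_segment[OF inverse_power_summable[of 2, where 'a = real], of "K + 2"]
    by (simp add: inverse_eq_divide add_ac)
  have bound: "norm (e K) \<le> C * W * real (Suc K) ^ 4 * (real (Suc K) / real (K + 2)) ^ t" for t
  proof -
    define g where "g = (\<lambda>n. e n / of_nat (Suc n) ^ (t + 4))"
    have g: "g sums 0" using sums[of "t + 2"] unfolding g_def add.assoc by (simp only: numeral_plus_numeral add_num_simps)
    have "(\<Sum>i<K. g i) = 0" using less by (intro sum.neutral) (auto simp: g_def)
    hence gK: "(\<lambda>n. g (n + K)) sums 0" using g by (subst sums_iff_shift) simp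
    hence "(\<lambda>n. g (Suc n + K)) sums (- g K)"
      using sums_Suc_iff[of "\<lambda>n. g (n + K)" "- g K"] by simp
    hence "g K = - (\<Sum>n. g (Suc n + K))" by (simp add: sums_iff)
    have gb: "norm (g (Suc n + K)) \<le> C / real (K + 2) ^ t * (1 / real (n + K + 2) ^ 2)" for n
    proof -
      define N where "N = real (n + K + 2)"
      have N: "N \<ge> real (K + 2)" "N > 0" by (simp_all add: N_def)
      have "norm (g (Suc n + K)) = norm (e (Suc n + K)) / N ^ (t + 4)"
        unfolding g_def norm_divide norm_power norm_of_nat by (simp add: N_def add_ac)
      also have "\<dots> \<le> C * N ^ 2 / N ^ (t + 4)"
        using e[of "Suc n + K"] N by (intro divide_right_mono) (auto simp: N_def add_ac)
      also have "\<dots> = C / N ^ t * (1 / N ^ 2)"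
        using N by (simp add: power_add field_simps power_numeral_reduce)
      also have "\<dots> \<le> C / real (K + 2) ^ t * (1 / N ^ 2)"
        using N C by (intro mult_right_mono divide_left_mono power_mono mult_pos_pos zero_less_power) auto
      finally show ?thesis by (simp add: N_def)
    qed
    have "norm (g K) = norm (\<Sum>n. g (Suc n + K))" using \<open>g K = _\<close> by simp
    also have "\<dots> \<le> (\<Sum>n. C / real (K + 2) ^ t * (1 / real (n + K + 2) ^ 2))"
      by (rule norm_suminf_le[OF gb summable_mult[OF W]])
    also have "\<dots> = C / real (K + 2) ^ t * W" unfolding W_def by (rule suminf_mult[OF W])
    finally have "norm (e K) / real (Suc K) ^ (t + 4) \<le> C / real (K + 2) ^ t * W"
      by (simp add: g_def norm_divide norm_power del: of_nat_Suc)
    thus ?thesis by (simp add: field_simps power_add del: of_nat_Suc of_nat_add)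
  qed
  have "(\<lambda>t. C * W * real (Suc K) ^ 4 * (real (Suc K) / real (K + 2)) ^ t) \<longlonglongrightarrow> C * W * real (Suc K) ^ 4 * 0"
    by (intro tendsto_mult_left LIMSEQ_realpow_zero) auto
  hence "norm (e K) \<le> C * W * real (Suc K) ^ 4 * 0"
    by (rule LIMSEQ_le_const) (use bound in blast)
  thus "e K = 0" by simp
qed

lemma dirichlet_coeffs_unique:
  assumes "is_dirichlet_coeffs g F" "is_dirichlet_coeffs h F"
  shows "g = h"
proof
  fix n
  have "(\<lambda>n. (g (Suc n) - h (Suc n)) / of_nat (Suc n) ^ (t + 2)) sums 0" for t
  proof -
    have "(\<lambda>n. g (Suc n) / of_nat (Suc n) powr of_nat (t + 2) - h (Suc n) / of_nat (Suc n) powr of_nat (t + 2))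
       sums (F (of_nat (t + 2)) - F (of_nat (t + 2)))"
      by (intro sums_diff) (use assms in \<open>simp_all add: is_dirichlet_coeffs_def\<close>)
    thus ?thesis unfolding powr_nat'[OF disjI2] 
      by (subst (asm) (1 2) powr_nat') (simp_all add: diff_divide_distrib del: of_nat_Suc)
  qed
  from vanishing_coeffs[OF this] show "g n = h n"
    using assms by (cases n) (auto simp: is_dirichlet_coeffs_def)
qed

definition has_dirichlet_sum :: "(nat \<Rightarrow> complex) \<Rightarrow> (complex \<Rightarrow> complex) \<Rightarrow> bool" where
  "has_dirichlet_sum f F \<longleftrightarrow> f 0 = 0 \<and>
     (\<forall>s. Re s > 1 \<longrightarrow> ((\<lambda>n. f n / of_nat n powr s) has_sum F s) {0<..})"

lemma has_dirichlet_sumD: "has_dirichlet_sum f F \<Longrightarrow> is_dirichlet_coeffs f F"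
  unfolding has_dirichlet_sum_def is_dirichlet_coeffs_def
proof (intro conjI allI impI; elim conjE)
  fix s :: complex assume "1 < Re s"
    and "\<forall>s. 1 < Re s \<longrightarrow> ((\<lambda>n. f n / of_nat n powr s) has_sum F s) {0<..}"
  hence "((\<lambda>n. f n / of_nat n powr s) has_sum F s) {0<..}" by blast
  also have "?this \<longleftrightarrow> ((\<lambda>n. f (Suc n) / of_nat (Suc n) powr s) has_sum F s) UNIV"
    by (rule has_sum_reindex_bij_witness[of _ Suc "\<lambda>n. n - 1"]) auto
  finally show "(\<lambda>n. f (Suc n) / of_nat (Suc n) powr s) sums F s" by (rule has_sum_imp_sums)
qed

definition dirichlet_conv :: "(nat \<Rightarrow> complex) \<Rightarrow> (nat \<Rightarrow> complex) \<Rightarrow> nat \<Rightarrow> complex" where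
  "dirichlet_conv f g n = (\<Sum>(d, e) \<in> {(d, e). 0 < d \<and> 0 < e \<and> d * e = n}. f d * g e)"

lemma finite_divisor_pairs: "finite {(d, e). 0 < d \<and> 0 < e \<and> d * e = (n :: nat)}"
proof (rule finite_subset)
  show "{(d, e). 0 < d \<and> 0 < e \<and> d * e = n} \<subseteq> {..n} \<times> {..n}"
    by (auto simp: Suc_le_eq)
qed auto

lemma has_dirichlet_sum_conv:
  assumes "has_dirichlet_sum f F" "has_dirichlet_sum g G"
  shows "has_dirichlet_sum (dirichlet_conv f g) (\<lambda>s. F s * G s)"
  unfolding has_dirichlet_sum_def
proof (intro conjI allI impI)
  show "dirichlet_conv f g 0 = 0" by (auto simp: dirichlet_conv_def intro!: sum.neutral)
  fix s :: complex assume s: "Re s > 1"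
  define P where "P = {0 :: nat <..}"
  define x where "x = (\<lambda>n. f n / of_nat n powr s)"
  define y where "y = (\<lambda>n. g n / of_nat n powr s)"
  have x: "(x has_sum F s) P" and y: "(y has_sum G s) P"
    using assms s by (auto simp: has_dirichlet_sum_def x_def y_def P_def)
  have xa: "(\<lambda>n. norm (x n)) summable_on P" and ya: "(\<lambda>n. norm (y n)) summable_on P"
    using x y summable_on_iff_abs_summable_on_complex has_sum_imp_summable by blast+
  have "(\<lambda>p. norm (case p of (m, n) \<Rightarrow> x m * y n)) summable_on P \<times> P"
  proof (subst Infinite_Sum.abs_summable_on_Sigma_iff, intro conjI ballI)
    show "(\<lambda>n. norm (case (m, n) of (m, n) \<Rightarrow> x m * y n)) summable_on P" for m
      using summable_on_cmult_right[OF ya, of "norm (x m)"] by (simp add: norm_mult)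
    show "(\<lambda>m. norm (\<Sum>\<^sub>\<infinity>n\<in>P. norm (case (m, n) of (m, n) \<Rightarrow> x m * y n))) summable_on P"
      using summable_on_cmult_left[OF xa, of "\<Sum>\<^sub>\<infinity>n\<in>P. norm (y n)"]
      by (simp add: norm_mult infsum_cmult_right' infsum_nonneg)
  qed
  hence "(\<lambda>(m, n). x m * y n) summable_on P \<times> P" by (rule abs_summable_summable)
  hence "((\<lambda>(m, n). x m * y n) has_sum (F s * G s)) (P \<times> P)"
    by (intro has_sum_SigmaI[where g = "\<lambda>m. x m * G s"])
       (auto intro!: has_sum_cmult_right has_sum_cmult_left x y)
  also have "?this \<longleftrightarrow> ((\<lambda>(n, m, e). x m * y e) has_sum (F s * G s))
      (SIGMA n:P. {(d, e). 0 < d \<and> 0 < e \<and> d * e = n})"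
    by (rule has_sum_reindex_bij_witness[of _ snd "\<lambda>(m, n). (m * n, m, n)"]) (auto simp: P_def)
  finally have *: "((\<lambda>(n, m, e). x m * y e) has_sum (F s * G s))
      (SIGMA n:P. {(d, e). 0 < d \<and> 0 < e \<and> d * e = n})" .
  have "((\<lambda>n. dirichlet_conv f g n / of_nat n powr s) has_sum (F s * G s)) P"
  proof (rule has_sum_SigmaD[OF *])
    fix n assume "n \<in> P"
    show "((\<lambda>p. case (n, p) of (n, m, e) \<Rightarrow> x m * y e) has_sum
       (dirichlet_conv f g n / of_nat n powr s)) {(d, e). 0 < d \<and> 0 < e \<and> d * e = n}"
      unfolding dirichlet_conv_def sum_divide_distrib
      by (intro has_sum_finiteI finite_divisor_pairs sum.cong refl)
         (auto simp: x_def y_def powr_times_real[of "of_nat _" "of_nat _", simplified])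
  qed
  thus "((\<lambda>n. dirichlet_conv f g n / of_nat n powr s) has_sum (F s * G s)) {0<..}"
    by (simp add: P_def)
qed

lemma has_dirichlet_sum_one: "has_dirichlet_sum (\<lambda>n. if n = 1 then 1 else 0) (\<lambda>_. 1)"
  unfolding has_dirichlet_sum_def
proof (intro conjI allI impI)
  fix s :: complex
  show "((\<lambda>n. (if n = 1 then 1 else 0) / of_nat n powr s) has_sum 1) {0<..}"
    by (rule has_sum_finite_neutralI[of "{1}"]) auto
qed simp

lemma has_dirichlet_sum_power:
  assumes "has_dirichlet_sum f F"
  shows "\<exists>g. has_dirichlet_sum g (\<lambda>s. F s ^ k)"
proof (induction k)
  case 0
  show ?case using has_dirichlet_sum_one by auto
next
  case (Suc k)
  then obtain g where "has_dirichlet_sum g (\<lambda>s. F s ^ k)" by blast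
  from has_dirichlet_sum_conv[OF assms this] show ?case by auto
qed

lemma has_dirichlet_sum_dilate:
  assumes f: "has_dirichlet_sum f F" and c: "c > 0"
  shows "\<exists>g. has_dirichlet_sum g (\<lambda>s. F (of_nat c * s))"
proof -
  define r where "r = the_inv (\<lambda>n::nat. n ^ c)"
  define g where "g = (\<lambda>m. if m \<in> range (\<lambda>n. n ^ c) then f (r m) else 0)"
  have inj: "inj (\<lambda>n::nat. n ^ c)" using c by (auto intro!: injI dest: power_eq_imp_eq_base)
  have r: "r (n ^ c) = n" for n unfolding r_def by (rule the_inv_f_f[OF inj])
  have g: "g (n ^ c) = f n" for n by (simp add: g_def r)
  have "g 0 = 0" using g[of 0] f c by (simp add: has_dirichlet_sum_def power_0_left)
  moreover have "((\<lambda>n. g n / of_nat n powr s) has_sum F (of_nat c * s)) {0<..}" if s: "Re s > 1" for s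
  proof -
    have "1 < Re s * real c" using s c
      by (metis less_1_mult mult.right_neutral of_nat_1 of_nat_less_iff nat_less_le One_nat_def Suc_leI)
    hence "((\<lambda>n. f n / of_nat n powr (of_nat c * s)) has_sum F (of_nat c * s)) {0<..}"
      using f by (simp add: has_dirichlet_sum_def mult.commute)
    also have "?this \<longleftrightarrow> ((\<lambda>n. g n / of_nat n powr s) has_sum F (of_nat c * s)) ((\<lambda>n. n ^ c) ` {0<..})"
    proof (subst has_sum_reindex)
      show "inj_on (\<lambda>n. n ^ c) {0::nat<..}" using inj by (rule inj_on_subset) simp
      have "of_nat n powr (of_nat c * s) = of_nat (n ^ c) powr s" if "n > 0" for n :: nat
      proof -
        have "Ln (of_nat (n ^ c)) = of_real (ln (real (n ^ c)))"
          using that by (intro Ln_of_nat) simp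
        also have "\<dots> = of_nat c * of_real (ln (real n))" using that by (simp add: ln_realpow)
        also have "\<dots> = of_nat c * Ln (of_nat n)" using that by (simp add: Ln_of_nat)
        finally show ?thesis using that by (simp add: powr_def mult_ac)
      qed
      thus "((\<lambda>n. f n / of_nat n powr (of_nat c * s)) has_sum F (of_nat c * s)) {0<..} \<longleftrightarrow>
        (((\<lambda>n. g n / of_nat n powr s) \<circ> (\<lambda>n. n ^ c)) has_sum F (of_nat c * s)) {0<..}"
        by (intro has_sum_cong) (simp add: g)
    qed
    also have "\<dots> \<longleftrightarrow> ((\<lambda>n. g n / of_nat n powr s) has_sum F (of_nat c * s)) {0<..}"
    proof (rule has_sum_cong_neutral)
      fix m :: nat assume m: "m \<in> {0<..} - (\<lambda>n. n ^ c) ` {0<..}"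
      have "m \<notin> range (\<lambda>n. n ^ c)"
      proof
        assume "m \<in> range (\<lambda>n. n ^ c)"
        then obtain n where "m = n ^ c" by blast
        moreover from this m c have "n > 0" by (cases "n = 0") auto
        ultimately show False using m by blast
      qed
      thus "g m / of_nat m powr s = 0" by (simp add: g_def)
    qed auto
    finally show ?thesis .
  qed
  ultimately show ?thesis by (auto simp: has_dirichlet_sum_def)
qed

lemma bounded_has_dirichlet_sum:
  assumes "f 0 = 0" "\<And>n. norm (f n) \<le> 1"
  shows "has_dirichlet_sum f (\<lambda>s. \<Sum>\<^sub>\<infinity>n\<in>{0<..}. f n / of_nat n powr s)"
  unfolding has_dirichlet_sum_def
proof (intro conjI allI impI has_sum_infsum)
  fix s :: complex assume s: "Re s > 1"
  have "summable (\<lambda>n. norm (f n / of_nat n powr s))"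
  proof (rule summable_comparison_test')
    show "summable (\<lambda>n. real n powr - Re s)" using s by (simp add: summable_real_powr_iff)
    fix n
    have "norm (f n / of_nat n powr s) \<le> 1 / real n powr Re s"
      using assms(2)[of n] norm_powr_real_powr[of "of_nat n" s]
      by (cases "n = 0") (auto simp: norm_divide intro!: divide_right_mono)
    thus "norm (norm (f n / of_nat n powr s)) \<le> real n powr - Re s"
      by (simp add: powr_minus_divide)
  qed
  thus "(\<lambda>n. f n / of_nat n powr s) summable_on {0<..}"
    by (intro summable_on_subset_banach[OF norm_summable_imp_summable_on]) auto
qed (fact assms(1))

definition moebius :: "nat \<Rightarrow> complex" where
  "moebius n = (if squarefree n then (-1) ^ card (prime_factors n) else 0)"

lemma moebius_prime_mult:
  assumes "prime p" "\<not> p dvd d" "squarefree d"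
  shows "squarefree (p * d)" "moebius (p * d) = - moebius d"
proof -
  have "coprime p d" using assms by (simp add: prime_imp_coprime)
  thus sf: "squarefree (p * d)"
    by (rule squarefree_mult_coprime) (use assms squarefree_prime in auto)
  have "d \<noteq> 0" "p \<noteq> 0" using assms by (metis not_squarefree_0, auto)
  hence "prime_factors (p * d) = insert p (prime_factors d)"
    using assms by (auto simp: prime_factors_product prime_prime_factors)
  moreover have "p \<notin> prime_factors d" using assms by auto
  ultimately show "moebius (p * d) = - moebius d"
    using sf assms by (simp add: moebius_def)
qed

lemma sum_moebius:
  assumes n: "n > 1"
  shows "(\<Sum>d | d dvd n. moebius d) = 0"
proof -
  obtain p where p: "prime p" "p dvd n" using n prime_factor_nat[of n] by auto
  define D where "D = {d. d dvd n \<and> squarefree d \<and> \<not> p dvd d}"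
  have fin: "finite {d. d dvd n}" using n by (intro finite_divisors_nat) auto
  hence finD: "finite D" by (rule rev_finite_subset) (auto simp: D_def)
  have inj: "inj_on ((*) p) D" using p by (auto intro!: inj_onI)
  have "(\<Sum>d | d dvd n. moebius d) = (\<Sum>d\<in>D \<union> (*) p ` D. moebius d)"
  proof (rule sum.mono_neutral_right[OF fin])
    show "D \<union> (*) p ` D \<subseteq> {d. d dvd n}"
    proof -
      have "p * d dvd n" if "d \<in> D" for d
        using that p by (intro divides_mult) (auto simp: D_def prime_imp_coprime)
      thus ?thesis by (auto simp: D_def)
    qed
    show "\<forall>d\<in>{d. d dvd n} - (D \<union> (*) p ` D). moebius d = 0"
    proof (rule ballI, rule ccontr)
      fix d assume d: "d \<in> {d. d dvd n} - (D \<union> (*) p ` D)" and "moebius d \<noteq> 0"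
      hence sf: "squarefree d" by (auto simp: moebius_def split: if_splits)
      with d have "p dvd d" by (auto simp: D_def)
      then obtain e where e: "d = p * e" ..
      have "\<not> p dvd e"
      proof
        assume "p dvd e"
        hence "p ^ 2 dvd d" by (simp add: e power2_eq_square mult_dvd_mono)
        with sf have "p dvd 1" by (rule squarefreeD)
        with p show False by auto
      qed
      moreover have "squarefree e" using sf unfolding e by (rule squarefree_multD)
      moreover have "e dvd n" using d e by (auto intro: dvd_mult_right)
      ultimately have "e \<in> D" by (simp add: D_def)
      with d e show False by auto
    qed
  qed
  also have "\<dots> = (\<Sum>d\<in>D. moebius d) + (\<Sum>d\<in>(*) p ` D. moebius d)"
    using finD by (intro sum.union_disjoint) (auto simp: D_def)
  also have "(\<Sum>d\<in>(*) p ` D. moebius d) = (\<Sum>d\<in>D. - moebius d)"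
    using moebius_prime_mult p by (subst sum.reindex[OF inj]) (auto simp: D_def intro!: sum.cong)
  finally show ?thesis by (simp add: sum_negf)
qed

lemma zeta_has_dirichlet_sum: "has_dirichlet_sum (\<lambda>n. if n = 0 then 0 else 1) zeta"
proof -
  define f :: "nat \<Rightarrow> complex" where "f = (\<lambda>n. if n = 0 then 0 else 1)"
  define F where "F = (\<lambda>s. \<Sum>\<^sub>\<infinity>n\<in>{0<..}. f n / of_nat n powr s)"
  have f: "has_dirichlet_sum f F" unfolding F_def by (rule bounded_has_dirichlet_sum) (auto simp: f_def)
  have "F s = zeta s" if s: "Re s > 1" for s
  proof (rule sums_unique2)
    show "(\<lambda>n. f (Suc n) / of_nat (Suc n) powr s) sums F s"
      using has_dirichlet_sumD[OF f] s by (auto simp: is_dirichlet_coeffs_def)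
    show "(\<lambda>n. f (Suc n) / of_nat (Suc n) powr s) sums zeta s"
      using is_zeta_zeta s by (auto simp: is_zeta_def f_def)
  qed
  with f show ?thesis unfolding f_def has_dirichlet_sum_def by simp
qed

lemma inverse_zeta_has_dirichlet_sum: "has_dirichlet_sum moebius (\<lambda>s. 1 / zeta s)"
proof -
  define F where "F = (\<lambda>s. \<Sum>\<^sub>\<infinity>n\<in>{0<..}. moebius n / of_nat n powr s)"
  have F: "has_dirichlet_sum moebius F" unfolding F_def
    by (rule bounded_has_dirichlet_sum) (auto simp: moebius_def norm_power)
  have "dirichlet_conv moebius (\<lambda>n. if n = 0 then 0 else 1) = (\<lambda>n. if n = 1 then 1 else 0)"
  proof
    fix n :: nat
    show "dirichlet_conv moebius (\<lambda>n. if n = 0 then 0 else 1) n = (if n = 1 then 1 else 0)"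
    proof (cases "n = 0")
      case True
      thus ?thesis by (auto simp: dirichlet_conv_def intro!: sum.neutral)
    next
      case False
      have "dirichlet_conv moebius (\<lambda>n. if n = 0 then 0 else 1) n = (\<Sum>d | d dvd n. moebius d)"
        unfolding dirichlet_conv_def
        by (rule sum.reindex_bij_witness[of _ "\<lambda>d. (d, n div d)" fst]) (use False in \<open>auto intro: Nat.gr0I\<close>)
      also have "\<dots> = (if n = 1 then 1 else 0)"
      proof (cases "n = 1")
        case True
        thus ?thesis by (simp add: moebius_def)
      qed (use sum_moebius[of n] False in auto)
      finally show ?thesis .
    qed
  qed
  with has_dirichlet_sum_conv[OF F zeta_has_dirichlet_sum]
  have "has_dirichlet_sum (\<lambda>n. if n = 1 then 1 else 0) (\<lambda>s. F s * zeta s)" by simp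
  hence "F s * zeta s = 1" if "Re s > 1" for s
    using has_dirichlet_sum_one that unfolding has_dirichlet_sum_def
    by (auto intro: has_sum_unique)
  hence "F s = 1 / zeta s" if "Re s > 1" for s using that by (metis nonzero_eq_divide_eq mult_zero_right zero_neq_one)
  with F show ?thesis by (simp add: has_dirichlet_sum_def)
qed

lemma dirichlet_coeffsI: "is_dirichlet_coeffs g F \<Longrightarrow> is_dirichlet_coeffs (dirichlet_coeffs F) F"
  unfolding dirichlet_coeffs_def using dirichlet_coeffs_unique by (metis theI)

lemma mu_k_coeffs: "is_dirichlet_coeffs (mu_k k) (\<lambda>s. 1 / zeta s ^ k)"
  using has_dirichlet_sum_power[OF inverse_zeta_has_dirichlet_sum, of k]
  unfolding mu_k_def by (auto simp: power_one_over intro: dirichlet_coeffsI has_dirichlet_sumD)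

lemma f_k_coeffs:
  assumes "a > 0" "b > 0" "c > 0"
  shows "is_dirichlet_coeffs (f_k k a b c)
    (\<lambda>s. zeta (of_nat a * s) * zeta (of_nat b * s) / zeta (of_nat c * s) ^ k)"
proof -
  obtain A where A: "has_dirichlet_sum A (\<lambda>s. zeta (of_nat a * s))"
    using has_dirichlet_sum_dilate[OF zeta_has_dirichlet_sum] assms by blast
  obtain B where B: "has_dirichlet_sum B (\<lambda>s. zeta (of_nat b * s))"
    using has_dirichlet_sum_dilate[OF zeta_has_dirichlet_sum] assms by blast
  obtain M where M: "has_dirichlet_sum M (\<lambda>s. (1 / zeta s) ^ k)"
    using has_dirichlet_sum_power[OF inverse_zeta_has_dirichlet_sum] by blast
  obtain C where C: "has_dirichlet_sum C (\<lambda>s. (1 / zeta (of_nat c * s)) ^ k)"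
    using has_dirichlet_sum_dilate[OF M] assms by blast
  have "has_dirichlet_sum (dirichlet_conv (dirichlet_conv A B) C)
    (\<lambda>s. zeta (of_nat a * s) * zeta (of_nat b * s) / zeta (of_nat c * s) ^ k)"
    using has_dirichlet_sum_conv[OF has_dirichlet_sum_conv[OF A B] C] by (simp add: power_one_over)
  thus ?thesis unfolding f_k_def by (intro dirichlet_coeffsI has_dirichlet_sumD)
qed

lemma finite_u_k_index:
  assumes "a > 0" "c > 0" "n > 0"
  shows "finite {(l, d). 0 < l \<and> 0 < d \<and> l ^ a * d ^ c = (n :: nat)}"
proof (rule finite_subset)
  have "l \<le> l ^ a * d ^ c \<and> d \<le> l ^ a * d ^ c" if "0 < l" "0 < d" for l d :: nat
  proof -
    have "l \<le> l ^ a" "d \<le> d ^ c" using assms that by (auto intro: self_le_power)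
    moreover have "l ^ a \<ge> 1" "d ^ c \<ge> 1" using that by auto
    ultimately show ?thesis
      by (metis le_trans mult.commute mult_le_mono1 mult_le_mono2 mult.right_neutral)
  qed
  thus "{(l, d). 0 < l \<and> 0 < d \<and> l ^ a * d ^ c = n} \<subseteq> {..n} \<times> {..n}" by auto
qed auto

end

theory Submission
  imports Defs
begin

text \<open>
  Write \<open>\<Delta>\<close> for \<open>Delta_u k a c\<close>. Since \<open>f_k\<close> is the convolution of \<open>u_k\<close> with the indicator of the
  \<open>b\<close>-th powers, the hyperbola method with an integer parameter \<open>N\<close> and \<open>z = x / N ^ b\<close> expresses its
  summatory function through \<open>\<Delta> (x / m ^ b)\<close> for \<open>m \<le> N\<close>, a partial sum of \<open>zeta (b / a)\<close>, and
  \<open>\<Sum>n\<le>z. u_k n * (n powr (-s) - z powr (-s))\<close> at \<open>s = 1 / b\<close>, with an error \<open>O(z powr (1 / a))\<close> from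
  rounding. The last sum minus its main term has derivative \<open>s * z powr (-s - 1) * \<Delta> z\<close> in \<open>z\<close>, so it
  converges locally uniformly in \<open>s\<close> to the right of the exponent of \<open>\<Delta>\<close>; by analytic continuation
  the limit is \<open>zeta (a * s) / zeta (c * s) ^ k\<close>. The Riemann hypothesis enters only through
  \<open>zeta (c / b) \<noteq> 0\<close>. Balancing \<open>x powr \<beta> * N powr (1 - b * \<beta>)\<close> against
  \<open>x powr (1 / a) * N powr (- b / a)\<close> gives the exponent.
\<close>

section \<open>Convolutions over power pairs\<close>

text \<open>Complex \<open>powr\<close> uses the principal logarithm, for which exponents need not
  multiply. A positive integer has a real logarithm, so no branch correction appears.\<close>

lemma of_nat_power_powr:
  assumes "n > 0"
  shows "of_nat (n ^ c) powr s = (of_nat n :: complex) powr (of_nat c * s)"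
proof -
  have "Ln (of_nat (n ^ c)) = of_real (ln (real (n ^ c)))"
    using assms by (intro Ln_of_nat) simp
  also have "\<dots> = of_nat c * Ln (of_nat n)" using assms by (simp add: ln_realpow Ln_of_nat)
  finally show ?thesis using assms by (simp add: powr_def mult_ac)
qed

text \<open>For negative \<open>x\<close> the function \<open>nat\<close> returns 0; positivity of
  \<open>n\<close> makes both sides false there.\<close>

lemma le_nat_floor_iff: "n > 0 \<Longrightarrow> n \<le> nat \<lfloor>x\<rfloor> \<longleftrightarrow> real n \<le> x"
  by linarith

lemma le_powr_inverse_iff:
  assumes "n > 0" "y > 0"
  shows "real m \<le> y powr (1 / real n) \<longleftrightarrow> real m ^ n \<le> y"
proof -
  have "y = (y powr (1 / real n)) ^ n"
    using assms by (simp add: powr_realpow[symmetric] powr_powr)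
  thus ?thesis using power_mono_iff[of "real m" "y powr (1 / real n)" n] assms by simp
qed

lemma finite_power_pairs:
  assumes "a > 0" "c > 0"
  shows "finite {(l, d). 0 < l \<and> 0 < d \<and> l ^ a * d ^ c = (n :: nat)}"
proof (cases "n = 0")
  case True
  have "{(l, d). 0 < l \<and> 0 < d \<and> l ^ a * d ^ c = n} = {}" using True by auto
  thus ?thesis by (simp only: finite.emptyI)
next
  case False
  thus ?thesis by (intro finite_u_k_index assms) simp
qed

text \<open>Absolute convergence allows the product of the two series to be regrouped by the value
  of \<open>l ^ a * d ^ c\<close>. The exponents are kept general so that the same statement yields
  both \<open>u_k\<close> (exponents \<open>a\<close> and \<open>c\<close>) and \<open>f_k\<close>
  (exponents \<open>b\<close> and \<open>1\<close>).\<close>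

lemma has_dirichlet_sum_power_conv:
  assumes f: "has_dirichlet_sum f F" and g: "has_dirichlet_sum g G" and pos: "a > 0" "c > 0"
  shows "has_dirichlet_sum (\<lambda>n. \<Sum>(l, d)\<in>{(l, d). 0 < l \<and> 0 < d \<and> l ^ a * d ^ c = n}. f l * g d)
           (\<lambda>s. F (of_nat a * s) * G (of_nat c * s))"
  unfolding has_dirichlet_sum_def
proof (intro conjI allI impI)
  show "(\<Sum>(l, d)\<in>{(l, d). 0 < l \<and> 0 < d \<and> l ^ a * d ^ c = 0}. f l * g d) = 0"
    by (auto intro!: sum.neutral)
  fix s :: complex assume s: "Re s > 1"
  define P where "P = {0 :: nat <..}"
  define x where "x = (\<lambda>n. f n / of_nat n powr (of_nat a * s))"
  define y where "y = (\<lambda>n. g n / of_nat n powr (of_nat c * s))"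
  have re: "Re (of_nat m * s) > 1" if "m > 0" for m
  proof -
    have "1 * Re s \<le> real m * Re s" using that s by (intro mult_right_mono) auto
    hence "1 < real m * Re s" using s by linarith
    thus ?thesis by simp
  qed
  have x: "(x has_sum F (of_nat a * s)) P" and y: "(y has_sum G (of_nat c * s)) P"
    using f g re pos by (auto simp: has_dirichlet_sum_def x_def y_def P_def)
  \<comment> \<open>For complex families unordered summability is already absolute
    summability.\<close>
  have xa: "(\<lambda>n. norm (x n)) summable_on P" and ya: "(\<lambda>n. norm (y n)) summable_on P"
    using x y summable_on_iff_abs_summable_on_complex has_sum_imp_summable by blast+
  have "(\<lambda>p. norm (case p of (m, n) \<Rightarrow> x m * y n)) summable_on P \<times> P"
  proof (subst Infinite_Sum.abs_summable_on_Sigma_iff, intro conjI ballI)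
    show "(\<lambda>n. norm (case (m, n) of (m, n) \<Rightarrow> x m * y n)) summable_on P" for m
      using summable_on_cmult_right[OF ya, of "norm (x m)"] by (simp add: norm_mult)
    show "(\<lambda>m. norm (\<Sum>\<^sub>\<infinity>n\<in>P. norm (case (m, n) of (m, n) \<Rightarrow> x m * y n))) summable_on P"
      using summable_on_cmult_left[OF xa, of "\<Sum>\<^sub>\<infinity>n\<in>P. norm (y n)"]
      by (simp add: norm_mult infsum_cmult_right' infsum_nonneg)
  qed
  hence "(\<lambda>(m, n). x m * y n) summable_on P \<times> P" by (rule abs_summable_summable)
  hence "((\<lambda>(m, n). x m * y n) has_sum (F (of_nat a * s) * G (of_nat c * s))) (P \<times> P)"
    by (intro has_sum_SigmaI[where g = "\<lambda>m. x m * G (of_nat c * s)"])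
       (auto intro!: has_sum_cmult_right has_sum_cmult_left x y)
  \<comment> \<open>Each pair is tagged with its value \<open>m ^ a * n ^ c\<close>; the fibres over
    a fixed value are finite and give the coefficients.\<close>
  also have "?this \<longleftrightarrow> ((\<lambda>(n, m, e). x m * y e) has_sum (F (of_nat a * s) * G (of_nat c * s)))
      (SIGMA n:P. {(l, d). 0 < l \<and> 0 < d \<and> l ^ a * d ^ c = n})"
    by (rule has_sum_reindex_bij_witness[of _ snd "\<lambda>(m, n). (m ^ a * n ^ c, m, n)"]) (auto simp: P_def)
  finally have *: "((\<lambda>(n, m, e). x m * y e) has_sum (F (of_nat a * s) * G (of_nat c * s)))
      (SIGMA n:P. {(l, d). 0 < l \<and> 0 < d \<and> l ^ a * d ^ c = n})" .
  have "((\<lambda>n. (\<Sum>(l, d)\<in>{(l, d). 0 < l \<and> 0 < d \<and> l ^ a * d ^ c = n}. f l * g d) / of_nat n powr s)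
      has_sum (F (of_nat a * s) * G (of_nat c * s))) P"
  proof (rule has_sum_SigmaD[OF *])
    fix n assume "n \<in> P"
    have eq: "f l * g d / of_nat (l ^ a * d ^ c) powr s = x l * y d" if "0 < l" "0 < d" for l d
    proof -
      have "of_nat (l ^ a * d ^ c) powr s = (of_nat (l ^ a) powr s * of_nat (d ^ c) powr s :: complex)"
        using powr_times_real[of "of_nat (l ^ a)" "of_nat (d ^ c)" s] by simp
      thus ?thesis using that by (simp only: of_nat_power_powr x_def y_def times_divide_times_eq)
    qed
    show "((\<lambda>p. case (n, p) of (n, m, e) \<Rightarrow> x m * y e) has_sum
       ((\<Sum>(l, d)\<in>{(l, d). 0 < l \<and> 0 < d \<and> l ^ a * d ^ c = n}. f l * g d) / of_nat n powr s))
         {(l, d). 0 < l \<and> 0 < d \<and> l ^ a * d ^ c = n}"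
      unfolding sum_divide_distrib
      by (intro has_sum_finiteI finite_power_pairs sum.cong refl pos) (auto simp: eq[symmetric])
  qed
  thus "((\<lambda>n. (\<Sum>(l, d)\<in>{(l, d). 0 < l \<and> 0 < d \<and> l ^ a * d ^ c = n}. f l * g d) / of_nat n powr s)
      has_sum (F (of_nat a * s) * G (of_nat c * s))) {0<..}"
    by (simp add: P_def)
qed

section \<open>Dirichlet series of the coefficient functions\<close>

lemma mu_k_has_dirichlet_sum: "has_dirichlet_sum (mu_k k) (\<lambda>s. 1 / zeta s ^ k)"
proof -
  obtain M where M: "has_dirichlet_sum M (\<lambda>s. (1 / zeta s) ^ k)"
    using has_dirichlet_sum_power[OF inverse_zeta_has_dirichlet_sum] by blast
  \<comment> \<open>\<open>mu_k_coeffs\<close> only provides convergence in the natural order.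
    Uniqueness identifies \<open>mu_k k\<close> with the coefficients \<open>M\<close> of a power of
    the \<open>moebius\<close> series, which converges unconditionally.\<close>
  hence "M = mu_k k"
    using dirichlet_coeffs_unique[OF has_dirichlet_sumD mu_k_coeffs, of M k] by (simp add: power_one_over)
  with M show ?thesis by (simp add: power_one_over)
qed

lemma u_k_has_dirichlet_sum:
  assumes "a > 0" "c > 0"
  shows "has_dirichlet_sum (u_k k a c) (\<lambda>s. zeta (of_nat a * s) / zeta (of_nat c * s) ^ k)"
proof -
  have "(\<lambda>n. \<Sum>(l, d)\<in>{(l, d). 0 < l \<and> 0 < d \<and> l ^ a * d ^ c = n}. (if l = 0 then 0 else 1) * mu_k k d)
     = u_k k a c"
    by (intro ext) (auto simp: u_k_def intro!: sum.cong)
  with has_dirichlet_sum_power_conv[OF zeta_has_dirichlet_sum mu_k_has_dirichlet_sum assms, of k]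
  show ?thesis by simp
qed

text \<open>Coefficients of a Dirichlet series are unique, so it suffices to factor the generating
  function as \<open>zeta (b * s)\<close> times the series of \<open>u_k\<close>.\<close>

lemma f_k_eq:
  assumes "a > 0" "b > 0" "c > 0"
  shows "f_k k a b c n = (\<Sum>(m, j)\<in>{(m, j). 0 < m \<and> 0 < j \<and> m ^ b * j = n}. u_k k a c j)"
proof -
  let ?g = "\<lambda>n. \<Sum>(m, j)\<in>{(m, j). 0 < m \<and> 0 < j \<and> m ^ b * j ^ 1 = n}. (if m = 0 then 0 else 1) * u_k k a c j"
  have "has_dirichlet_sum ?g (\<lambda>s. zeta (of_nat a * s) * zeta (of_nat b * s) / zeta (of_nat c * s) ^ k)"
    using has_dirichlet_sum_power_conv[OF zeta_has_dirichlet_sum u_k_has_dirichlet_sum, of a c b 1 k] assms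
    by (simp add: mult_ac)
  from dirichlet_coeffs_unique[OF f_k_coeffs has_dirichlet_sumD[OF this]] assms
  have "f_k k a b c n = ?g n" by simp
  also have "\<dots> = (\<Sum>(m, j)\<in>{(m, j). 0 < m \<and> 0 < j \<and> m ^ b * j = n}. u_k k a c j)"
    by (intro sum.cong) auto
  finally show ?thesis .
qed

text \<open>For fixed \<open>d\<close> at most \<open>(t / d ^ c) powr (1 / a)\<close> values of
  \<open>l\<close> occur, and the series of \<open>norm (mu_k k d) * d powr (- c / a)\<close>
  converges because \<open>c / a > 1\<close>. The bound later absorbs the rounding error.\<close>

lemma u_k_abs_sum_bound:
  assumes a: "a > 0" and ac: "a < c"
  obtains K where "\<And>t. t \<ge> 1 \<Longrightarrow> (\<Sum>n\<in>{1..nat \<lfloor>t\<rfloor>}. norm (u_k k a c n)) \<le> K * t powr (1 / real a)"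
proof -
  have c: "c > 0" using ac by simp
  define q where "q = real c / real a"
  define K where "K = (\<Sum>\<^sub>\<infinity>d\<in>{0<..}. norm (mu_k k d / of_nat d powr complex_of_real q))"
  have "q > 1" using a ac by (simp add: q_def)
  hence "((\<lambda>d. mu_k k d / of_nat d powr complex_of_real q) has_sum (1 / zeta q ^ k)) {0<..}"
    using mu_k_has_dirichlet_sum[of k] by (simp add: has_dirichlet_sum_def)
  from has_sum_imp_summable[OF this]
  have sm: "(\<lambda>d. norm (mu_k k d / of_nat d powr complex_of_real q)) summable_on {0<..}"
    by (simp only: summable_on_iff_abs_summable_on_complex)
  have "(\<Sum>n\<in>{1..nat \<lfloor>t\<rfloor>}. norm (u_k k a c n)) \<le> K * t powr (1 / real a)" if t: "t \<ge> 1" for t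
  proof -
    define M where "M = nat \<lfloor>t\<rfloor>"
    define L where "L = (\<lambda>d::nat. nat \<lfloor>(t / real d ^ c) powr (1 / real a)\<rfloor>)"
    have "(\<Sum>n\<in>{1..M}. norm (u_k k a c n))
        \<le> (\<Sum>n\<in>{1..M}. \<Sum>(l, d)\<in>{(l, d). 0 < l \<and> 0 < d \<and> l ^ a * d ^ c = n}. norm (mu_k k d))"
      unfolding u_k_def by (intro sum_mono order_trans[OF norm_sum] sum_mono) auto
    also have "\<dots> = (\<Sum>(n, l, d)\<in>(SIGMA n:{1..M}. {(l, d). 0 < l \<and> 0 < d \<and> l ^ a * d ^ c = n}). norm (mu_k k d))"
      by (subst sum.Sigma) (auto intro!: finite_power_pairs a c)
    also have "\<dots> \<le> (\<Sum>(d, l)\<in>(SIGMA d:{1..M}. {1..L d}). norm (mu_k k d))"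
    proof -
      have inj: "inj_on (\<lambda>(n, l, d). (d, l)) (SIGMA n:{1..M}. {(l, d). 0 < l \<and> 0 < d \<and> l ^ a * d ^ c = n})"
        by (auto simp: inj_on_def)
      have "(\<Sum>(n, l, d)\<in>(SIGMA n:{1..M}. {(l, d). 0 < l \<and> 0 < d \<and> l ^ a * d ^ c = n}). norm (mu_k k d))
        = (\<Sum>(d, l)\<in>(\<lambda>(n, l, d). (d, l)) ` (SIGMA n:{1..M}. {(l, d). 0 < l \<and> 0 < d \<and> l ^ a * d ^ c = n}). norm (mu_k k d))"
        by (subst sum.reindex[OF inj]) (auto intro!: sum.cong)
      also have "\<dots> \<le> (\<Sum>(d, l)\<in>(SIGMA d:{1..M}. {1..L d}). norm (mu_k k d))"
      proof (rule sum_mono2)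
        show "(\<lambda>(n, l, d). (d, l)) ` (SIGMA n:{1..M}. {(l, d). 0 < l \<and> 0 < d \<and> l ^ a * d ^ c = n})
               \<subseteq> (SIGMA d:{1..M}. {1..L d})"
        proof
          fix p assume "p \<in> (\<lambda>(n, l, d). (d, l)) ` (SIGMA n:{1..M}. {(l, d). 0 < l \<and> 0 < d \<and> l ^ a * d ^ c = n})"
          then obtain d l where p: "p = (d, l)" and ld: "0 < l" "0 < d" "l ^ a * d ^ c \<le> M" by auto
          have "d \<le> d ^ c" using c ld by (intro self_le_power) auto
          also have "\<dots> \<le> l ^ a * d ^ c" using ld by auto
          finally have 1: "d \<le> M" using ld by simp
          have "real (l ^ a * d ^ c) \<le> t" using ld le_nat_floor_iff[of "l ^ a * d ^ c" t] by (simp add: M_def)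
          hence "real l ^ a \<le> t / real d ^ c" using ld by (simp add: field_simps)
          hence "real l \<le> (t / real d ^ c) powr (1 / real a)"
            using a ld t by (subst le_powr_inverse_iff) auto
          hence "l \<le> L d" using ld by (simp add: L_def le_nat_floor_iff)
          thus "p \<in> (SIGMA d:{1..M}. {1..L d})" using 1 ld by (auto simp: p)
        qed
      qed auto
      finally show ?thesis .
    qed
    also have "\<dots> = (\<Sum>d\<in>{1..M}. real (L d) * norm (mu_k k d))"
      by (subst sum.Sigma[symmetric]) auto
    also have "\<dots> \<le> (\<Sum>d\<in>{1..M}. t powr (1 / real a) * norm (mu_k k d / of_nat d powr complex_of_real q))"
    proof (rule sum_mono)
      fix d assume d: "d \<in> {1..M}"
      have "real (L d) \<le> (t / real d ^ c) powr (1 / real a)" unfolding L_def by (simp add: of_nat_floor)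
      also have "\<dots> = t powr (1 / real a) / real d powr q"
        using d t by (simp add: powr_divide powr_realpow[symmetric] powr_powr q_def)
      finally have "real (L d) * norm (mu_k k d) \<le> t powr (1 / real a) / real d powr q * norm (mu_k k d)"
        by (rule mult_right_mono) simp
      thus "real (L d) * norm (mu_k k d) \<le> t powr (1 / real a) * norm (mu_k k d / of_nat d powr complex_of_real q)"
        using norm_powr_real_powr[of "of_nat d" q] by (simp add: norm_divide)
    qed
    also have "\<dots> = t powr (1 / real a) * (\<Sum>d\<in>{1..M}. norm (mu_k k d / of_nat d powr complex_of_real q))"
      by (simp add: sum_distrib_left)
    also have "\<dots> \<le> t powr (1 / real a) * K"
      unfolding K_def by (intro mult_left_mono finite_sum_le_infsum sm) auto
    finally show ?thesis by (simp add: M_def mult.commute)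
  qed
  thus ?thesis by (rule that)
qed

text \<open>The pairs with \<open>m ^ b * j \<le> x\<close> are split at \<open>m = N\<close>. For
  \<open>m > N\<close> the condition forces \<open>j \<le> x / N ^ b\<close>, and each such
  \<open>j\<close> is paired with exactly the \<open>m\<close> from \<open>N + 1\<close> to the
  floor of \<open>(x / j) powr (1 / b)\<close>.\<close>

lemma hyperbola_sum:
  fixes u :: "nat \<Rightarrow> complex"
  assumes b: "b > 0" and N: "N > 0" and x: "real N ^ b \<le> x"
  shows "(\<Sum>n\<in>{1..nat \<lfloor>x\<rfloor>}. \<Sum>(m, j)\<in>{(m, j). 0 < m \<and> 0 < j \<and> m ^ b * j = n}. u j)
    = (\<Sum>m\<in>{1..N}. \<Sum>j\<in>{1..nat \<lfloor>x / real m ^ b\<rfloor>}. u j)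
      + (\<Sum>j\<in>{1..nat \<lfloor>x / real N ^ b\<rfloor>}. (of_nat (nat \<lfloor>(x / real j) powr (1 / real b)\<rfloor>) - of_nat N) * u j)"
proof -
  define L where "L = (\<lambda>j::nat. nat \<lfloor>(x / real j) powr (1 / real b)\<rfloor>)"
  define A where "A = (SIGMA m:{1..N}. {1..nat \<lfloor>x / real m ^ b\<rfloor>})"
  define B where "B = (SIGMA j:{1..nat \<lfloor>x / real N ^ b\<rfloor>}. {N<..L j})"
  have x0: "x > 0" using x N by (meson less_le_trans of_nat_0_less_iff zero_less_power)
  have memA: "(m, j) \<in> A \<longleftrightarrow> 0 < m \<and> m \<le> N \<and> 0 < j \<and> real (m ^ b * j) \<le> x" for m j
    unfolding A_def using le_nat_floor_iff[of j "x / real m ^ b"] by (auto simp: field_simps)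
  have Lle: "m \<le> L j \<longleftrightarrow> real (m ^ b * j) \<le> x" if "0 < m" "0 < j" for m j
  proof -
    have "m \<le> L j \<longleftrightarrow> real m \<le> (x / real j) powr (1 / real b)"
      using that by (simp add: L_def le_nat_floor_iff)
    also have "\<dots> \<longleftrightarrow> real m ^ b \<le> x / real j"
      using b x0 that by (intro le_powr_inverse_iff) auto
    finally show ?thesis using that by (simp add: field_simps)
  qed
  have memB: "(j, m) \<in> B \<longleftrightarrow> N < m \<and> 0 < j \<and> real (m ^ b * j) \<le> x" for m j
  proof -
    have "real (N ^ b * j) \<le> x" if "N < m" "real (m ^ b * j) \<le> x"
    proof -
      have "N ^ b * j \<le> m ^ b * j" using that by (intro mult_right_mono power_mono) auto
      thus ?thesis using that by (meson of_nat_mono order_trans)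
    qed
    thus ?thesis unfolding B_def using N le_nat_floor_iff[of j "x / real N ^ b"] Lle[of m j]
      by (auto simp: field_simps)
  qed
  have "(\<Sum>n\<in>{1..nat \<lfloor>x\<rfloor>}. \<Sum>(m, j)\<in>{(m, j). 0 < m \<and> 0 < j \<and> m ^ b * j = n}. u j)
    = (\<Sum>(n, m, j)\<in>(SIGMA n:{1..nat \<lfloor>x\<rfloor>}. {(m, j). 0 < m \<and> 0 < j \<and> m ^ b * j = n}). u j)"
    using finite_power_pairs[of b 1] b by (subst sum.Sigma) auto
  also have "\<dots> = (\<Sum>(m, j)\<in>A \<union> prod.swap ` B. u j)"
    by (rule sum.reindex_bij_witness[of _ "\<lambda>(m, j). (m ^ b * j, m, j)" snd])
       (use N in \<open>auto simp: memA memB le_nat_floor_iff simp del: of_nat_mult of_nat_power\<close>)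
  also have "\<dots> = (\<Sum>(m, j)\<in>A. u j) + (\<Sum>(m, j)\<in>prod.swap ` B. u j)"
    by (rule sum.union_disjoint) (auto simp: A_def B_def)
  also have "(\<Sum>(m, j)\<in>prod.swap ` B. u j) = (\<Sum>(j, m)\<in>B. u j)"
    by (subst sum.reindex) (auto intro!: sum.cong)
  also have "(\<Sum>(m, j)\<in>A. u j) = (\<Sum>m\<in>{1..N}. \<Sum>j\<in>{1..nat \<lfloor>x / real m ^ b\<rfloor>}. u j)"
    unfolding A_def by (subst sum.Sigma[symmetric]) auto
  also have "(\<Sum>(j, m)\<in>B. u j) = (\<Sum>j\<in>{1..nat \<lfloor>x / real N ^ b\<rfloor>}. of_nat (L j - N) * u j)"
    unfolding B_def by (subst sum.Sigma[symmetric]) auto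
  also have "\<dots> = (\<Sum>j\<in>{1..nat \<lfloor>x / real N ^ b\<rfloor>}. (of_nat (L j) - of_nat N) * u j)"
  proof (rule sum.cong)
    fix j assume j: "j \<in> {1..nat \<lfloor>x / real N ^ b\<rfloor>}"
    hence "real j \<le> x / real N ^ b" using le_nat_floor_iff[of j] by auto
    \<comment> \<open>This makes truncated subtraction of naturals agree with subtraction of complex
      numbers.\<close>
    hence "N \<le> L j" using N j by (subst Lle) (auto simp: field_simps)
    thus "of_nat (L j - N) * u j = (of_nat (L j) - of_nat N) * u j" by (simp add: of_nat_diff)
  qed simp
  finally show ?thesis by (simp add: L_def)
qed

section \<open>Abel summation and the limit of the remainder\<close>

lemma has_vector_derivative_of_real_powr:
  assumes "z > 0"
  shows "((\<lambda>z. of_real z powr w :: complex) has_vector_derivative w * of_real z powr (w - 1)) (at z)"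
  by (rule has_vector_derivative_real_field[of "\<lambda>x. x powr w"], rule has_field_derivative_powr)
     (use assms in auto)

lemma continuous_on_of_real_powr:
  assumes "\<And>z. z \<in> S \<Longrightarrow> f z > 0" "continuous_on S f"
  shows "continuous_on S (\<lambda>z. of_real (f z) powr w :: complex)"
proof -
  have "of_real (f z) \<notin> (\<real>\<^sub>\<le>\<^sub>0 :: complex set)" if "z \<in> S" for z
    using assms(1)[OF that] by (auto simp: complex_nonpos_Reals_iff)
  thus ?thesis using assms(2)
    by (intro continuous_on_powr_complex continuous_intros)
       (auto intro: less_imp_le[OF assms(1)] dest: assms(1))
qed

text \<open>Abstract setting of a summatory function with a power main term and a smaller power
  error. It is used with \<open>u_k\<close>, \<open>\<rho> = 1 / a\<close> and
  \<open>A = 1 / zeta (c / a) ^ k\<close>.\<close>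

locale summatory_asymptotics =
  fixes u :: "nat \<Rightarrow> complex" and A :: complex and \<rho> \<beta> C :: real
  assumes \<beta>_less: "\<beta> < \<rho>"
    and bound: "t \<ge> 1 \<Longrightarrow> norm ((\<Sum>n\<in>{1..nat \<lfloor>t\<rfloor>}. u n) - A * of_real (t powr \<rho>)) \<le> C * t powr \<beta>"
begin

text \<open>By Abel summation the sum is the integral from 1 to \<open>z\<close> of
  \<open>s * t powr (-s - 1)\<close> times the summatory function; the subtracted term is an
  antiderivative of the part coming from \<open>A * t powr \<rho>\<close>. The weights vanish at
  \<open>n = z\<close>, so nothing jumps at integers.\<close>

definition remainder :: "complex \<Rightarrow> real \<Rightarrow> complex" where
  "remainder s z = (\<Sum>n\<in>{1..nat \<lfloor>z\<rfloor>}. u n * (of_nat n powr (-s) - of_real z powr (-s)))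
     - A * s / (of_real \<rho> - s) * of_real z powr (of_real \<rho> - s)"

lemma C_nonneg: "C \<ge> 0"
  using bound[of 1] norm_ge_zero by (metis dual_order.refl mult.right_neutral order_trans powr_one_eq_one)

text \<open>Away from the integers the derivative in \<open>z\<close> is
  \<open>s * z powr (-s - 1)\<close> times the error of the summatory function. Its norm is at most
  a constant times \<open>z powr (\<beta> - Re s - 1)\<close>, which is integrable up to
  infinity.\<close>

lemma remainder_diff_bound:
  assumes s: "Re s > \<beta>" "s \<noteq> of_real \<rho>" and z: "1 \<le> z1" "z1 \<le> z2"
  shows "norm (remainder s z2 - remainder s z1) \<le> norm s * C / (Re s - \<beta>) * z1 powr (\<beta> - Re s)"
proof -
  define M where "M = nat \<lfloor>z2\<rfloor>"
  \<comment> \<open>With \<open>max\<close> the range of summation no longer depends on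
    \<open>z\<close>: terms with \<open>n \<ge> z\<close> vanish, and the sum can be differentiated
    term by term.\<close>
  define E where "E = (\<lambda>z. (\<Sum>n\<in>{1..M}. u n * (of_nat n powr (-s) - of_real (max (real n) z) powr (-s)))
     - A * s / (of_real \<rho> - s) * of_real z powr (of_real \<rho> - s))"
  define D where "D = (\<lambda>t. (\<Sum>n\<in>{1..nat \<lfloor>t\<rfloor>}. u n) - A * of_real (t powr \<rho>))"
  define h where "h = (\<lambda>z. norm s * C / (\<beta> - Re s) * z powr (\<beta> - Re s))"
  have E: "remainder s z = E z" if "z \<in> {z1..z2}" for z
  proof -
    have "(\<Sum>n\<in>{1..nat \<lfloor>z\<rfloor>}. u n * (of_nat n powr (-s) - of_real z powr (-s)))
        = (\<Sum>n\<in>{1..M}. u n * (of_nat n powr (-s) - of_real (max (real n) z) powr (-s)))"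
    proof (rule sum.mono_neutral_cong_left)
      show "{1..nat \<lfloor>z\<rfloor>} \<subseteq> {1..M}" using that unfolding M_def
        by (auto intro!: nat_mono floor_mono order_trans[of _ "nat \<lfloor>z\<rfloor>"])
      show "\<forall>n\<in>{1..M} - {1..nat \<lfloor>z\<rfloor>}. u n * (of_nat n powr (-s) - of_real (max (real n) z) powr (-s)) = 0"
      proof
        fix n assume "n \<in> {1..M} - {1..nat \<lfloor>z\<rfloor>}"
        hence "z \<le> real n" using that z by auto linarith
        thus "u n * (of_nat n powr (-s) - of_real (max (real n) z) powr (-s)) = 0" by (simp add: max_def)
      qed
      fix n assume "n \<in> {1..nat \<lfloor>z\<rfloor>}"
      hence "real n \<le> z" using that z by auto linarith
      thus "u n * (of_nat n powr (-s) - of_real z powr (-s))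
        = u n * (of_nat n powr (-s) - of_real (max (real n) z) powr (-s))" by (simp add: max_def)
    qed simp
    thus ?thesis by (simp add: remainder_def E_def)
  qed
  have int: "((\<lambda>z. s * of_real z powr (-s-1) * D z) has_integral (E z2 - E z1)) {z1..z2}"
  \<comment> \<open>The integers up to \<open>M\<close> are the only points where \<open>max\<close>
    may have a kink; continuity suffices there.\<close>
  proof (rule fundamental_theorem_of_calculus_interior_strong[of "real ` {1..M}"])
    show "continuous_on {z1..z2} E" unfolding E_def
      by (intro continuous_intros continuous_on_of_real_powr) (use z in auto)
    fix x assume x: "x \<in> {z1<..<z2} - real ` {1..M}"
    have x0: "x > 0" using x z by auto
    have d: "((\<lambda>z. of_nat n powr (-s) - of_real (max (real n) z) powr (-s)) has_vector_derivative
        (if real n \<le> x then s * of_real x powr (-s-1) else 0)) (at x)" if n: "n \<in> {1..M}" for n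
    proof (cases "real n < x")
      case True
      have "((\<lambda>z. of_nat n powr (-s) - of_real z powr (-s)) has_vector_derivative
        0 - (-s) * of_real x powr (-s-1)) (at x)"
        by (intro has_vector_derivative_diff has_vector_derivative_const has_vector_derivative_of_real_powr x0)
      thus ?thesis
        by (rule has_vector_derivative_transform_within_open[where S = "{real n<..}", THEN has_vector_derivative_eq_rhs])
           (use True in auto)
    next
      case False
      hence "x < real n" using x n by (cases "x = real n") auto
      have "((\<lambda>z. 0) has_vector_derivative (0::complex)) (at x)" by simp
      thus ?thesis
        by (rule has_vector_derivative_transform_within_open[where S = "{..<real n}", THEN has_vector_derivative_eq_rhs])
           (use \<open>x < real n\<close> in auto)
    qed
    have "(E has_vector_derivative
        (\<Sum>n\<in>{1..M}. u n * (if real n \<le> x then s * of_real x powr (-s-1) else 0))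
        - A * s / (of_real \<rho> - s) * ((of_real \<rho> - s) * of_real x powr (of_real \<rho> - s - 1))) (at x)"
      unfolding E_def
      by (intro has_vector_derivative_diff has_vector_derivative_sum has_vector_derivative_mult_right d
          has_vector_derivative_of_real_powr x0)
    moreover have "(\<Sum>n\<in>{1..M}. u n * (if real n \<le> x then s * of_real x powr (-s-1) else 0))
        = (\<Sum>n\<in>{1..nat \<lfloor>x\<rfloor>}. u n * (s * of_real x powr (-s-1)))"
    proof (rule sum.mono_neutral_cong_right)
      show "{1..nat \<lfloor>x\<rfloor>} \<subseteq> {1..M}" using x unfolding M_def
        by (auto intro!: nat_mono floor_mono order_trans[of _ "nat \<lfloor>x\<rfloor>"])
      show "\<forall>n\<in>{1..M} - {1..nat \<lfloor>x\<rfloor>}. u n * (if real n \<le> x then s * of_real x powr (-s-1) else 0) = 0"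
        using x0 by auto linarith
      fix n assume "n \<in> {1..nat \<lfloor>x\<rfloor>}"
      hence "real n \<le> x" using x0 by auto linarith
      thus "u n * (if real n \<le> x then s * of_real x powr (-s-1) else 0) = u n * (s * of_real x powr (-s-1))"
        by simp
    qed simp
    moreover have "A * s / (of_real \<rho> - s) * ((of_real \<rho> - s) * of_real x powr (of_real \<rho> - s - 1))
       = A * of_real (x powr \<rho>) * (s * of_real x powr (-s-1))"
    proof -
      have "complex_of_real x powr (of_real \<rho> - s - 1) = of_real x powr of_real \<rho> * of_real x powr (-s-1)"
        by (subst powr_add[symmetric]) (simp add: algebra_simps)
      thus ?thesis using s x0 by (simp add: powr_of_real)
    qed
    ultimately have "(E has_vector_derivative (\<Sum>n\<in>{1..nat \<lfloor>x\<rfloor>}. u n) * (s * of_real x powr (-s-1))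
        - A * of_real (x powr \<rho>) * (s * of_real x powr (-s-1))) (at x)"
      by (simp only: sum_distrib_right)
    thus "(E has_vector_derivative s * of_real x powr (-s-1) * D x) (at x)"
      by (simp add: D_def algebra_simps)
  qed (use z in auto)
  have int_h: "((\<lambda>z. norm s * C * z powr (\<beta> - Re s - 1)) has_integral (h z2 - h z1)) {z1..z2}"
  proof (rule fundamental_theorem_of_calculus)
    fix x assume x: "x \<in> {z1..z2}"
    have "(h has_real_derivative (norm s * C / (\<beta> - Re s) * ((\<beta> - Re s) * x powr (\<beta> - Re s - 1)))) (at x)"
      unfolding h_def by (intro DERIV_cmult has_real_derivative_powr) (use x z in auto)
    also have "norm s * C / (\<beta> - Re s) * ((\<beta> - Re s) * x powr (\<beta> - Re s - 1))
        = norm s * C * x powr (\<beta> - Re s - 1)" using s by simp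
    finally show "(h has_vector_derivative norm s * C * x powr (\<beta> - Re s - 1)) (at x within {z1..z2})"
      by (meson has_real_derivative_iff_has_vector_derivative has_vector_derivative_at_within)
  qed (use z in auto)
  have "norm (remainder s z2 - remainder s z1) = norm (E z2 - E z1)" using E z by simp
  also have "\<dots> = norm (integral {z1..z2} (\<lambda>z. s * of_real z powr (-s-1) * D z))"
    using int by (simp add: integral_unique)
  also have "\<dots> \<le> integral {z1..z2} (\<lambda>z. norm s * C * z powr (\<beta> - Re s - 1))"
  proof (rule integral_norm_bound_integral)
    show "(\<lambda>z. s * of_real z powr (-s-1) * D z) integrable_on {z1..z2}" using int by blast
    show "(\<lambda>z. norm s * C * z powr (\<beta> - Re s - 1)) integrable_on {z1..z2}" using int_h by blast
    fix x assume x: "x \<in> {z1..z2}"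
    have "norm (s * of_real x powr (-s-1) * D x) = norm s * x powr (- Re s - 1) * norm (D x)"
      using x z norm_powr_real_powr[of "of_real x" "-s-1"] by (simp add: norm_mult)
    also have "\<dots> \<le> norm s * x powr (- Re s - 1) * (C * x powr \<beta>)"
      using bound[of x] x z by (intro mult_left_mono) (auto simp: D_def)
    also have "\<dots> = norm s * C * (x powr \<beta> * x powr (- Re s - 1))" by simp
    also have "\<dots> = norm s * C * x powr (\<beta> - Re s - 1)"
      by (subst powr_add[symmetric]) (simp add: algebra_simps)
    finally show "norm (s * of_real x powr (-s-1) * D x) \<le> norm s * C * x powr (\<beta> - Re s - 1)" .
  qed
  also have "\<dots> = h z2 - h z1" using int_h by (rule integral_unique)
  \<comment> \<open>\<open>h\<close> is nonpositive because \<open>\<beta> - Re s < 0\<close>, so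
    the upper endpoint is dropped and the bound is uniform in \<open>z2\<close>.\<close>
  also have "\<dots> \<le> - h z1"
    using s C_nonneg by (simp add: h_def mult_nonneg_nonpos2 divide_nonneg_nonpos mult_nonpos_nonneg)
  also have "- h z1 = norm s * C / (Re s - \<beta>) * z1 powr (\<beta> - Re s)"
    using s by (simp add: h_def field_simps)
  finally show ?thesis .
qed

section \<open>The limit of the remainder: existence, rate, holomorphy, value\<close>

definition remainder_lim :: "complex \<Rightarrow> complex" where
  "remainder_lim s = lim (\<lambda>n. remainder s (real (Suc n)))"

lemma Suc_powr_tendsto_0: "e < 0 \<Longrightarrow> (\<lambda>n. real (Suc n) powr e) \<longlonglongrightarrow> 0"
  by (rule LIMSEQ_Suc, rule tendsto_neg_powr[OF _ filterlim_real_sequentially])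

text \<open>The difference bound depends only on the smaller argument and tends to 0, so the
  sequence is Cauchy. Sampling at \<open>Suc n\<close> keeps the argument at least 1.\<close>

lemma remainder_tendsto:
  assumes s: "Re s > \<beta>" "s \<noteq> of_real \<rho>"
  shows "(\<lambda>n. remainder s (real (Suc n))) \<longlonglongrightarrow> remainder_lim s"
proof -
  define B where "B = norm s * C / (Re s - \<beta>)"
  have lim: "(\<lambda>n. B * real (Suc n) powr (\<beta> - Re s)) \<longlonglongrightarrow> B * 0"
    by (intro tendsto_mult_left Suc_powr_tendsto_0) (use s in auto)
  have "Cauchy (\<lambda>n. remainder s (real (Suc n)))"
    unfolding Cauchy_altdef2
  proof (intro allI impI)
    fix e :: real assume "e > 0"
    with lim have "eventually (\<lambda>n. B * real (Suc n) powr (\<beta> - Re s) < e) sequentially"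
      by (intro order_tendstoD(2)) auto
    then obtain N where N: "B * real (Suc N) powr (\<beta> - Re s) < e"
      unfolding eventually_sequentially by blast
    have "dist (remainder s (real (Suc n))) (remainder s (real (Suc N))) < e" if "n \<ge> N" for n
      using remainder_diff_bound[OF s, of "real (Suc N)" "real (Suc n)"] that N
      unfolding dist_norm B_def by simp
    thus "\<exists>N. \<forall>n\<ge>N. dist (remainder s (real (Suc n))) (remainder s (real (Suc N))) < e" by blast
  qed
  thus ?thesis unfolding remainder_lim_def by (simp add: Cauchy_convergent_iff convergent_LIMSEQ_iff)
qed

text \<open>Letting \<open>z2\<close> run to infinity along the integers leaves the right side of
  the difference bound unchanged. The rate thus holds at every real \<open>z\<close>, although the
  limit is defined along integers.\<close>

lemma remainder_lim_bound:
  assumes s: "Re s > \<beta>" "s \<noteq> of_real \<rho>" and z: "z \<ge> 1"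
  shows "norm (remainder s z - remainder_lim s) \<le> norm s * C / (Re s - \<beta>) * z powr (\<beta> - Re s)"
proof -
  have "(\<lambda>n. norm (remainder s (real (Suc n)) - remainder s z)) \<longlonglongrightarrow> norm (remainder_lim s - remainder s z)"
    by (intro tendsto_norm tendsto_diff tendsto_const remainder_tendsto s)
  moreover have "eventually (\<lambda>n. norm (remainder s (real (Suc n)) - remainder s z)
      \<le> norm s * C / (Re s - \<beta>) * z powr (\<beta> - Re s)) sequentially"
    using eventually_ge_at_top[of "nat \<lceil>z\<rceil>"]
  proof eventually_elim
    case (elim n)
    hence "z \<le> real (Suc n)" by linarith
    thus ?case by (rule remainder_diff_bound[OF s z])
  qed
  ultimately have "norm (remainder_lim s - remainder s z) \<le> norm s * C / (Re s - \<beta>) * z powr (\<beta> - Re s)"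
    by (rule tendsto_upperbound) simp
  thus ?thesis by (simp add: norm_minus_commute)
qed

text \<open>Locally uniform limits of holomorphic functions are holomorphic. On a disc of radius at
  most half the distance to the line \<open>Re s = \<beta>\<close> the rate of convergence is
  uniform.\<close>

lemma remainder_lim_holomorphic: "remainder_lim holomorphic_on {s. Re s > \<beta>} - {of_real \<rho>}"
proof (rule holomorphic_uniform_sequence)
  show op: "open ({s. Re s > \<beta>} - {of_real \<rho>})"
    by (intro open_Diff open_halfspace_Re_gt) auto
  show "(\<lambda>s. remainder s (real (Suc n))) holomorphic_on {s. Re s > \<beta>} - {of_real \<rho>}" for n
    unfolding remainder_def by (intro holomorphic_intros) (auto simp del: of_nat_Suc)
  fix x assume x: "x \<in> {s. Re s > \<beta>} - {of_real \<rho>}"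
  then obtain d0 where d0: "d0 > 0" "cball x d0 \<subseteq> {s. Re s > \<beta>} - {of_real \<rho>}"
    using op open_contains_cball by blast
  define \<delta> where "\<delta> = (Re x - \<beta>) / 2"
  define d where "d = min d0 \<delta>"
  define R where "R = norm x + d"
  have \<delta>: "\<delta> > 0" using x by (simp add: \<delta>_def)
  have d: "d > 0" "cball x d \<subseteq> {s. Re s > \<beta>} - {of_real \<rho>}" using d0 \<delta> by (auto simp: d_def)
  have y: "Re y - \<beta> \<ge> \<delta>" "norm y \<le> R" if "y \<in> cball x d" for y
  proof -
    have n: "norm (x - y) \<le> d" using that by (simp add: dist_norm)
    have "Re x - Re y \<le> norm (x - y)" using complex_Re_le_cmod[of "x - y"] by simp
    also have "\<dots> \<le> \<delta>" using n by (simp add: d_def)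
    finally show "Re y - \<beta> \<ge> \<delta>" by (simp add: \<delta>_def field_simps)
    show "norm y \<le> R" using norm_triangle_ineq2[of y x] n by (simp add: R_def norm_minus_commute)
  qed
  have "uniform_limit (cball x d) (\<lambda>n s. remainder s (real (Suc n))) remainder_lim sequentially"
  proof (rule uniform_limitI)
    fix e :: real assume "e > 0"
    have "(\<lambda>n. R * C / \<delta> * real (Suc n) powr (- \<delta>)) \<longlonglongrightarrow> R * C / \<delta> * 0"
      by (intro tendsto_mult_left Suc_powr_tendsto_0) (use \<delta> in auto)
    hence "eventually (\<lambda>n. R * C / \<delta> * real (Suc n) powr (- \<delta>) < e) sequentially"
      using \<open>e > 0\<close> by (intro order_tendstoD(2)) auto
    thus "\<forall>\<^sub>F n in sequentially. \<forall>y\<in>cball x d. dist (remainder y (real (Suc n))) (remainder_lim y) < e"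
    proof eventually_elim
      case (elim n)
      show ?case
      proof
        fix y assume yd: "y \<in> cball x d"
        have "norm (remainder y (real (Suc n)) - remainder_lim y)
            \<le> norm y * C / (Re y - \<beta>) * real (Suc n) powr (\<beta> - Re y)"
          using d yd by (intro remainder_lim_bound) auto
        also have "\<dots> \<le> R * C / \<delta> * real (Suc n) powr (- \<delta>)"
          using y[OF yd] C_nonneg \<delta> order_trans[OF norm_ge_zero y(2)[OF yd]]
          by (intro mult_mono frac_le powr_mono mult_right_mono) auto
        finally show "dist (remainder y (real (Suc n))) (remainder_lim y) < e"
          using elim by (simp add: dist_norm)
      qed
    qed
  qed
  with d show "\<exists>d>0. cball x d \<subseteq> {s. Re s > \<beta>} - {of_real \<rho>} \<and>
      uniform_limit (cball x d) (\<lambda>n s. remainder s (real (Suc n))) remainder_lim sequentially" by blast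
qed

text \<open>Multiplied out, the remainder at \<open>z\<close> is a partial Dirichlet sum minus two
  terms of size \<open>z powr (\<rho> - Re s)\<close>, which vanish in the limit as
  \<open>Re s > 1 \<ge> \<rho>\<close>.\<close>

lemma remainder_lim_eq_dirichlet_sum:
  assumes u: "has_dirichlet_sum u F" and \<rho>: "\<rho> \<le> 1" and s: "Re s > 1"
  shows "remainder_lim s = F s"
proof (rule LIMSEQ_unique)
  have "s \<noteq> of_real \<rho>" using s \<rho> by auto
  thus "(\<lambda>n. remainder s (real (Suc n))) \<longlonglongrightarrow> remainder_lim s"
    using s \<rho> \<beta>_less by (intro remainder_tendsto) auto
  have eq: "remainder s (real (Suc n)) = (\<Sum>m<Suc n. u (Suc m) / of_nat (Suc m) powr s)
      - (\<Sum>m\<in>{1..Suc n}. u m) * of_nat (Suc n) powr (-s)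
      - A * s / (of_real \<rho> - s) * of_nat (Suc n) powr (of_real \<rho> - s)" for n
  proof -
    have "(\<Sum>m<Suc n. u (Suc m) / of_nat (Suc m) powr s) = (\<Sum>m\<in>{1..Suc n}. u m * of_nat m powr (-s))"
      by (rule sum.reindex_bij_witness[of _ "\<lambda>m. m - 1" Suc]) (auto simp: powr_minus divide_inverse)
    thus ?thesis
      by (simp add: remainder_def right_diff_distrib sum_subtractf sum_distrib_right del: of_nat_Suc sum.cl_ivl_Suc sum.lessThan_Suc)
  qed
  have "(\<lambda>n. \<Sum>m<Suc n. u (Suc m) / of_nat (Suc m) powr s) \<longlonglongrightarrow> F s"
    using has_dirichlet_sumD[OF u] s by (intro LIMSEQ_Suc) (auto simp: is_dirichlet_coeffs_def sums_def)
  moreover have "(\<lambda>n. (\<Sum>m\<in>{1..Suc n}. u m) * of_nat (Suc n) powr (-s)) \<longlonglongrightarrow> 0"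
  proof (rule Lim_null_comparison)
    show "\<forall>\<^sub>F n in sequentially. norm ((\<Sum>m\<in>{1..Suc n}. u m) * of_nat (Suc n) powr (-s))
       \<le> (norm A + C) * real (Suc n) powr (\<rho> - Re s)"
    proof (intro always_eventually allI)
      fix n
      define t where "t = real (Suc n)"
      have t: "t \<ge> 1" by (simp add: t_def)
      have "norm (\<Sum>m\<in>{1..Suc n}. u m) \<le> norm (A * of_real (t powr \<rho>))
          + norm ((\<Sum>m\<in>{1..Suc n}. u m) - A * of_real (t powr \<rho>))"
        by (rule norm_triangle_sub)
      also have "\<dots> \<le> norm A * t powr \<rho> + C * t powr \<beta>"
        using bound[OF t] by (simp add: norm_mult t_def del: of_nat_Suc sum.cl_ivl_Suc)
      also have "\<dots> \<le> norm A * t powr \<rho> + C * t powr \<rho>"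
        using \<beta>_less t C_nonneg by (intro add_left_mono mult_left_mono powr_mono) auto
      finally have "norm (\<Sum>m\<in>{1..Suc n}. u m) * t powr (- Re s) \<le> (norm A + C) * t powr \<rho> * t powr (- Re s)"
        by (intro mult_right_mono) (auto simp: algebra_simps)
      also have "\<dots> = (norm A + C) * t powr (\<rho> - Re s)" by (simp add: powr_diff powr_minus divide_inverse)
      finally show "norm ((\<Sum>m\<in>{1..Suc n}. u m) * of_nat (Suc n) powr (-s))
          \<le> (norm A + C) * real (Suc n) powr (\<rho> - Re s)"
        using norm_powr_real_powr[of "of_nat (Suc n)" "-s"]
        by (simp add: norm_mult t_def del: of_nat_Suc sum.cl_ivl_Suc)
    qed
    show "(\<lambda>n. (norm A + C) * real (Suc n) powr (\<rho> - Re s)) \<longlonglongrightarrow> 0"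
      using s \<rho> by (intro tendsto_mult_right_zero Suc_powr_tendsto_0) auto
  qed
  moreover have "(\<lambda>n. A * s / (of_real \<rho> - s) * of_nat (Suc n) powr (of_real \<rho> - s)) \<longlonglongrightarrow> 0"
  proof (rule tendsto_mult_right_zero, rule tendsto_norm_zero_cancel)
    have "norm (of_nat (Suc n) powr (of_real \<rho> - s) :: complex) = real (Suc n) powr (\<rho> - Re s)" for n
      using norm_powr_real_powr[of "of_nat (Suc n)" "of_real \<rho> - s"] by (simp del: of_nat_Suc)
    thus "(\<lambda>n. norm (of_nat (Suc n) powr (of_real \<rho> - s) :: complex)) \<longlonglongrightarrow> 0"
      using Suc_powr_tendsto_0[of "\<rho> - Re s"] s \<rho> by (simp del: of_nat_Suc)
  qed
  ultimately have "(\<lambda>n. remainder s (real (Suc n))) \<longlonglongrightarrow> F s - 0 - 0"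
    unfolding eq by (intro tendsto_diff)
  thus "(\<lambda>n. remainder s (real (Suc n))) \<longlonglongrightarrow> F s" by simp
qed

end

section \<open>Values of zeta\<close>

text \<open>The corrected partial sum \<open>e n\<close> decreases, while
  \<open>e n - n powr (-q)\<close> increases, and both converge to \<open>zeta q\<close>. The value
  is therefore enclosed in an interval of length \<open>N powr (-q)\<close>.\<close>

lemma zeta_partial_sum:
  assumes q: "q > 1" and N: "N > 0"
  shows "norm (of_real (\<Sum>m\<in>{1..N}. real m powr (-q)) + of_real (real N powr (1 - q) / (q - 1)) - zeta (of_real q))
    \<le> real N powr (-q)"
proof -
  define e where "e = (\<lambda>n. (\<Sum>m\<in>{1..n}. real m powr (-q)) + real n powr (1 - q) / (q - 1))"
  define Z where "Z = (\<Sum>m. real (Suc m) powr (-q))"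
  have sm: "summable (\<lambda>m. real (Suc m) powr (-q))" using q by (intro summable_Suc_powr) auto
  have Z: "of_real Z = zeta (of_real q)"
  proof (rule sums_unique2)
    show "(\<lambda>n. of_real (real (Suc n) powr (-q))) sums complex_of_real Z"
      unfolding Z_def by (intro sums_of_real summable_sums sm)
    have "(\<lambda>n. 1 / of_nat (Suc n) powr complex_of_real q) sums zeta (of_real q)"
      using is_zeta_zeta q by (simp add: is_zeta_def)
    also have "(\<lambda>n. 1 / of_nat (Suc n) powr complex_of_real q) = (\<lambda>n. of_real (real (Suc n) powr (-q)))"
      using powr_of_real[of "real (Suc _)" q] by (auto simp: powr_minus_divide simp del: of_nat_Suc)
    finally show "(\<lambda>n. of_real (real (Suc n) powr (-q))) sums zeta (of_real q)" .
  qed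
  have lim: "(\<lambda>n. e (Suc n)) \<longlonglongrightarrow> Z"
  proof -
    have "(\<lambda>n. real n powr (1 - q)) \<longlonglongrightarrow> 0"
      using q by (intro tendsto_neg_powr filterlim_real_sequentially) auto
    hence "(\<lambda>n. (\<Sum>m<n. real (Suc m) powr (-q)) + real n powr (1 - q) / (q - 1)) \<longlonglongrightarrow> Z + 0 / (q - 1)"
      unfolding Z_def by (intro tendsto_add summable_LIMSEQ sm tendsto_divide tendsto_const) (use q in auto)
    moreover have "(\<Sum>m<n. real (Suc m) powr (-q)) = (\<Sum>m\<in>{1..n}. real m powr (-q))" for n
      by (rule sum.reindex_bij_witness[of _ "\<lambda>m. m - 1" Suc]) auto
    ultimately show ?thesis by (intro LIMSEQ_Suc) (simp add: e_def)
  qed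
  have step: "e (Suc n) \<le> e n" "e n - real n powr (-q) \<le> e (Suc n) - real (Suc n) powr (-q)" if n: "n > 0" for n
  proof -
    \<comment> \<open>The correction term changes by \<open>- (\<xi> powr (-q))\<close> with
      \<open>\<xi>\<close> between \<open>n\<close> and \<open>n + 1\<close>; comparing with the
      powers at the two endpoints gives both inequalities.\<close>
    have "\<exists>\<xi>>real n. \<xi> < real (Suc n) \<and> real (Suc n) powr (1 - q) / (q - 1) - real n powr (1 - q) / (q - 1)
        = (real (Suc n) - real n) * (- (\<xi> powr (-q)))"
    proof (rule MVT2)
      fix t assume "real n \<le> t"
      hence "t > 0" using n by simp
      hence "((\<lambda>t. t powr (1 - q) / (q - 1)) has_real_derivative ((1 - q) * t powr (1 - q - 1)) / (q - 1)) (at t)"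
        by (intro DERIV_cdivide has_real_derivative_powr)
      moreover have "((1 - q) * t powr (1 - q - 1)) / (q - 1) = - (t powr (-q))" using q by (simp add: field_simps)
      ultimately show "((\<lambda>t. t powr (1 - q) / (q - 1)) has_real_derivative - (t powr (-q))) (at t)" by simp
    qed simp
    then obtain \<xi> where \<xi>: "real n < \<xi>" "\<xi> < real (Suc n)"
      "real (Suc n) powr (1 - q) / (q - 1) - real n powr (1 - q) / (q - 1) = - (\<xi> powr (-q))" by auto
    have "real (Suc n) powr (-q) \<le> \<xi> powr (-q)" "\<xi> powr (-q) \<le> real n powr (-q)"
      using \<xi> n q by (auto intro!: powr_mono2')
    thus "e (Suc n) \<le> e n" "e n - real n powr (-q) \<le> e (Suc n) - real (Suc n) powr (-q)"
      using \<xi>(3) by (simp_all add: e_def del: of_nat_Suc)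
  qed
  have "decseq (\<lambda>n. e (Suc n))" by (intro decseq_SucI step) simp
  from decseq_ge[OF this lim, of "N - 1"] N have 1: "Z \<le> e N" by simp
  have "incseq (\<lambda>n. e (Suc n) - real (Suc n) powr (-q))" by (intro incseq_SucI step) simp
  moreover have "(\<lambda>n. e (Suc n) - real (Suc n) powr (-q)) \<longlonglongrightarrow> Z - 0"
    by (intro tendsto_diff lim LIMSEQ_Suc tendsto_neg_powr filterlim_real_sequentially) (use q in auto)
  ultimately have "e (Suc (N - 1)) - real (Suc (N - 1)) powr (-q) \<le> Z - 0" by (rule incseq_le)
  with N have 2: "e N - real N powr (-q) \<le> Z" by simp
  have "of_real (\<Sum>m\<in>{1..N}. real m powr (-q)) + of_real (real N powr (1 - q) / (q - 1)) - zeta (of_real q)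
      = complex_of_real (e N - Z)" by (simp add: e_def Z[symmetric])
  thus ?thesis using 1 2 by (simp only: norm_of_real)
qed

text \<open>It is applied with \<open>p = b * \<beta>\<close>, which may be negative. For
  \<open>p \<ge> 0\<close> the sum is compared with the integral of \<open>t powr (-p)\<close>; for
  \<open>p < 0\<close> every term is at most the last. The constant covers both cases.\<close>

lemma sum_powr_bound:
  fixes p :: real
  assumes p: "p < 1"
  shows "(\<Sum>m\<in>{1..N}. real m powr (-p)) \<le> (1 + 1 / (1 - p)) * real N powr (1 - p)"
proof (cases "p \<ge> 0")
  case True
  have "(\<Sum>m\<in>{1..N}. real m powr (-p)) \<le> real N powr (1 - p) / (1 - p)"
  proof (induction N)
    case (Suc N)
    have "real (Suc N) powr (-p) \<le> real (Suc N) powr (1 - p) / (1 - p) - real N powr (1 - p) / (1 - p)"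
    \<comment> \<open>The mean value argument needs a positive left endpoint, so the first term is
      treated directly: \<open>0 powr (1 - p) = 0\<close> and
      \<open>1 \<le> 1 / (1 - p)\<close>.\<close>
    proof (cases "N = 0")
      case True
      thus ?thesis using p \<open>p \<ge> 0\<close> by simp
    next
      case False
      have "\<exists>\<xi>>real N. \<xi> < real (Suc N) \<and> real (Suc N) powr (1 - p) / (1 - p) - real N powr (1 - p) / (1 - p)
          = (real (Suc N) - real N) * \<xi> powr (-p)"
      proof (rule MVT2)
        fix t assume "real N \<le> t"
        hence "t > 0" using False by simp
        hence "((\<lambda>t. t powr (1 - p) / (1 - p)) has_real_derivative ((1 - p) * t powr (1 - p - 1)) / (1 - p)) (at t)"
          by (intro DERIV_cdivide has_real_derivative_powr)
        thus "((\<lambda>t. t powr (1 - p) / (1 - p)) has_real_derivative t powr (-p)) (at t)" using p by simp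
      qed simp
      then obtain \<xi> where \<xi>: "real N < \<xi>" "\<xi> < real (Suc N)"
        "real (Suc N) powr (1 - p) / (1 - p) - real N powr (1 - p) / (1 - p) = \<xi> powr (-p)" by auto
      have "real (Suc N) powr (-p) \<le> \<xi> powr (-p)" using \<xi> True False by (intro powr_mono2') auto
      thus ?thesis using \<xi>(3) by simp
    qed
    thus ?case using Suc by (simp del: of_nat_Suc)
  qed simp
  also have "\<dots> \<le> (1 + 1 / (1 - p)) * real N powr (1 - p)" by (simp add: algebra_simps)
  finally show ?thesis .
next
  case False
  have "(\<Sum>m\<in>{1..N}. real m powr (-p)) \<le> (\<Sum>m\<in>{1..N}. real N powr (-p))"
    using False by (intro sum_mono powr_mono2) auto
  also have "\<dots> = 1 * real N powr (1 - p)"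
    by (cases "N = 0") (simp_all add: powr_diff powr_minus divide_inverse)
  also have "\<dots> \<le> (1 + 1 / (1 - p)) * real N powr (1 - p)"
    using p by (intro mult_right_mono) auto
  finally show ?thesis .
qed

text \<open>A convergent series of positive terms has a positive sum. This provides a base point for
  the analytic continuation below.\<close>

lemma zeta_ne_zero_of_real:
  assumes "q > 1"
  shows "zeta (complex_of_real q) \<noteq> 0"
proof -
  have "(\<lambda>n. 1 / of_nat (Suc n) powr complex_of_real q) sums zeta (of_real q)"
    using is_zeta_zeta assms by (simp add: is_zeta_def)
  hence "(\<lambda>n. Re (1 / of_nat (Suc n) powr complex_of_real q)) sums Re (zeta (of_real q))"
    by (rule sums_Re)
  also have "(\<lambda>n. Re (1 / of_nat (Suc n) powr complex_of_real q)) = (\<lambda>n. real (Suc n) powr (-q))"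
  proof
    fix n
    have "1 / of_nat (Suc n) powr complex_of_real q = of_real (real (Suc n) powr (-q))"
      using powr_of_real[of "real (Suc n)" q] by (simp add: powr_minus_divide del: of_nat_Suc)
    thus "Re (1 / of_nat (Suc n) powr complex_of_real q) = real (Suc n) powr (-q)"
      by (simp only: Re_complex_of_real)
  qed
  finally have "(\<lambda>n. real (Suc n) powr (-q)) sums Re (zeta (of_real q))" .
  moreover have "0 < (\<Sum>n. real (Suc n) powr (-q))"
    by (intro suminf_pos) (use calculation in \<open>auto simp: sums_iff\<close>)
  ultimately show ?thesis by (auto simp: sums_iff)
qed

text \<open>Both sides are analytic on the half-plane without the poles, and they agree on an open
  set where the Dirichlet series converges. Clearing the denominator keeps the left side holomorphic
  at zeros of \<open>zeta (c * s)\<close>.\<close>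

lemma remainder_lim_u_k:
  assumes L: "summatory_asymptotics (u_k k a c) A (1 / real a) \<beta> C"
    and pos: "a > 0" "c > 0" and \<beta>: "\<beta> < 1"
    and s: "Re s > \<beta>" "s \<noteq> 1 / of_nat a" "s \<noteq> 1 / of_nat c"
  shows "summatory_asymptotics.remainder_lim (u_k k a c) A (1 / real a) s * zeta (of_nat c * s) ^ k
     = zeta (of_nat a * s)"
proof -
  interpret summatory_asymptotics "u_k k a c" A "1 / real a" \<beta> C by (rule L)
  define S where "S = {s. Re s > \<beta>} - {1 / of_nat a, 1 / of_nat c}"
  define H where "H = {s. Re s > 1}"
  have hol: "(\<lambda>s. zeta (of_nat m * s)) holomorphic_on - {1 / of_nat m}" if "m > 0" for m
  proof -
    have "(zeta \<circ> (\<lambda>s. of_nat m * s)) holomorphic_on - {1 / of_nat m}"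
    proof (rule holomorphic_on_compose_gen)
      show "zeta holomorphic_on - {1}" using is_zeta_zeta by (simp add: is_zeta_def)
    qed (use that in \<open>auto intro!: holomorphic_intros simp: field_simps\<close>)
    thus ?thesis by (simp add: o_def)
  qed
  have re: "Re (1 / of_nat m) \<le> 1" if "m > 0" for m :: nat
    using that by (simp add: Re_divide_of_nat)
  have HS: "H \<subseteq> S" using \<beta> re pos by (force simp: H_def S_def)
  have opH: "open H" unfolding H_def by (rule open_halfspace_Re_gt)
  have cont: "continuous_on H (\<lambda>s. zeta (of_nat c * s))"
    by (rule continuous_on_subset[OF holomorphic_on_imp_continuous_on[OF hol]])
       (use HS pos in \<open>auto simp: S_def\<close>)
  \<comment> \<open>The identity theorem asks for agreement on a nonempty open set. Restricting to
    nonzero \<open>zeta (c * s)\<close> makes the division legitimate, and \<open>2\<close> lies in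
    the set.\<close>
  define U where "U = H \<inter> (\<lambda>s. zeta (of_nat c * s)) -` (- {0})"
  show ?thesis
  proof (rule analytic_continuation_open[where s = U and s' = S
        and f = "\<lambda>s. remainder_lim s * zeta (of_nat c * s) ^ k" and g = "\<lambda>s. zeta (of_nat a * s)"])
    show "open U" unfolding U_def by (rule continuous_open_preimage[OF cont opH]) auto
    have "zeta (of_nat c * 2) \<noteq> 0"
      using zeta_ne_zero_of_real[of "real c * 2"] pos by simp
    hence "2 \<in> U" by (simp add: U_def H_def)
    thus "U \<noteq> {}" by blast
    show "open S" unfolding S_def by (intro open_Diff open_halfspace_Re_gt finite_imp_closed) auto
    show "connected S" unfolding S_def
      by (intro connected_open_delete_finite open_halfspace_Re_gt convex_connected convex_halfspace_Re_gt) auto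
    show "U \<subseteq> S" using HS by (auto simp: U_def)
    show "(\<lambda>s. remainder_lim s * zeta (of_nat c * s) ^ k) holomorphic_on S"
      by (intro holomorphic_intros holomorphic_on_subset[OF remainder_lim_holomorphic]
          holomorphic_on_subset[OF hol]) (use pos in \<open>auto simp: S_def\<close>)
    show "(\<lambda>s. zeta (of_nat a * s)) holomorphic_on S"
      by (rule holomorphic_on_subset[OF hol]) (use pos in \<open>auto simp: S_def\<close>)
    show "s \<in> S" using s by (simp add: S_def)
    fix w assume w: "w \<in> U"
    have "remainder_lim w = zeta (of_nat a * w) / zeta (of_nat c * w) ^ k"
      using w pos by (intro remainder_lim_eq_dirichlet_sum u_k_has_dirichlet_sum) (auto simp: U_def H_def)
    thus "remainder_lim w * zeta (of_nat c * w) ^ k = zeta (of_nat a * w)"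
      using w by (simp add: U_def)
  qed
qed

section \<open>Error terms\<close>

text \<open>\<open>N\<close> is left free here and chosen at the end. The first error term comes
  from \<open>Delta_u\<close> at \<open>x / m ^ b\<close> and from the tail of the remainder, the
  second from the partial sum of \<open>zeta (b / a)\<close> and from rounding.\<close>

lemma Delta_f_bound:
  assumes RH: riemann_hypothesis
    and pos: "0 < a" "0 < b" "0 < c"
    and order: "a < c" "c < b" "b < 2 * c"
    and \<beta>: "\<beta> < 1 / real b"
    and u_bound: "\<And>t. t \<ge> 1 \<Longrightarrow> norm (Delta_u k a c t) \<le> C * t powr \<beta>"
  obtains K where "\<And>x N. N > 0 \<Longrightarrow> real N ^ b \<le> x \<Longrightarrow>
    norm (Delta_f k a b c x) \<le> K * (x powr \<beta> * real N powr (1 - real b * \<beta>)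
        + x powr (1 / real a) * real N powr (- (real b / real a)))"
proof -
  define q where "q = real b / real a"
  define r where "r = 1 / real b"
  define s where "s = complex_of_real r"
  define A where "A = 1 / zeta (of_nat c / of_nat a) ^ k"
  define u where "u = u_k k a c"
  define Z where "Z = zeta (of_nat b / of_nat a)"
  define \<kappa> where "\<kappa> = zeta (of_nat a / of_nat b) / zeta (of_nat c / of_nat b) ^ k"
  have ab: "a < b" using order by simp
  have q: "q > 1" using ab pos by (simp add: q_def)
  have r: "1 / real a > r" "r \<le> 1" "r > \<beta>" "r > 0"
    using ab pos \<beta> by (simp_all add: r_def field_simps)
  interpret summatory_asymptotics u A "1 / real a" \<beta> C
  proof
    show "\<beta> < 1 / real a" using r by simp
    fix t :: real assume "t \<ge> 1"
    from u_bound[OF this]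
    show "norm ((\<Sum>n\<in>{1..nat \<lfloor>t\<rfloor>}. u n) - A * of_real (t powr (1 / real a))) \<le> C * t powr \<beta>"
      by (simp add: Delta_u_def A_def u_def)
  qed
  have Cnn: "C \<ge> 0" by (rule C_nonneg)
  have s: "Re s > \<beta>" "s \<noteq> of_real (1 / real a)" "s \<noteq> 1 / of_nat c"
  proof -
    show "Re s > \<beta>" using r by (simp add: s_def)
    show "s \<noteq> of_real (1 / real a)" using r unfolding s_def of_real_eq_iff by simp
    \<comment> \<open>As \<open>c < b\<close>, the point \<open>1 / b\<close> avoids the pole of
      \<open>zeta (c * s)\<close>.\<close>
    have "r \<noteq> 1 / real c" using order pos by (simp add: r_def)
    hence "s \<noteq> of_real (1 / real c)" unfolding s_def of_real_eq_iff .
    thus "s \<noteq> 1 / of_nat c" by simp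
  qed
  have \<kappa>: "remainder_lim s = \<kappa>"
  proof -
    have "remainder_lim s * zeta (of_nat c * s) ^ k = zeta (of_nat a * s)"
      using remainder_lim_u_k[of k a c A \<beta> C s] summatory_asymptotics_axioms r s pos
      by (simp add: u_def)
    \<comment> \<open>The inequalities \<open>c < b < 2 * c\<close> place \<open>c / b\<close>
      strictly between \<open>1 / 2\<close> and \<open>1\<close>, where the Riemann hypothesis
      allows no zero.\<close>
    moreover have "zeta (of_nat c / of_nat b) \<noteq> 0"
    proof
      have re: "Re (of_nat c / of_nat b) = real c / real b"
        by (metis Re_complex_of_real of_real_divide of_real_of_nat_eq)
      assume "zeta (of_nat c / of_nat b) = 0"
      moreover have "0 < real c / real b" "real c / real b < 1" using order pos by simp_all
      ultimately have "real c / real b = 1 / 2" using RH re unfolding riemann_hypothesis_def by metis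
      thus False using order pos by (simp add: field_simps)
    qed
    moreover have "of_nat c * s = of_nat c / of_nat b" "of_nat a * s = of_nat a / of_nat b"
      by (simp_all add: s_def r_def)
    ultimately show ?thesis by (simp add: \<kappa>_def field_simps)
  qed
  obtain K0 where K0: "\<And>t. t \<ge> 1 \<Longrightarrow> (\<Sum>n\<in>{1..nat \<lfloor>t\<rfloor>}. norm (u n)) \<le> K0 * t powr (1 / real a)"
    using u_k_abs_sum_bound[OF pos(1) order(1)] unfolding u_def by blast
  have K0nn: "K0 \<ge> 0" using K0[of 1] by (simp add: order_trans[OF norm_ge_zero])
  define p where "p = real b * \<beta>"
  have p: "p < 1" using \<beta> pos by (simp add: p_def field_simps)
  define K1 where "K1 = 1 + 1 / (1 - p)"
  define K2 where "K2 = norm s * C / (Re s - \<beta>)"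
  have K1nn: "K1 \<ge> 0" and K2nn: "K2 \<ge> 0" using p s Cnn by (simp_all add: K1_def K2_def)
  have "norm (Delta_f k a b c x) \<le> (C * K1 + norm A + K2 + K0) * (x powr \<beta> * real N powr (1 - p)
        + x powr (1 / real a) * real N powr (- q))"
    if N: "N > 0" and xN: "real N ^ b \<le> x" for x N
  proof -
    define z where "z = x / real N ^ b"
    define e1 where "e1 = x powr \<beta> * real N powr (1 - p)"
    define e2 where "e2 = x powr (1 / real a) * real N powr (- q)"
    have x0: "x > 0" using xN N by (meson less_le_trans of_nat_0_less_iff zero_less_power)
    have z1: "z \<ge> 1" using xN N by (simp add: z_def)
    have z_powr: "z powr w = x powr w * real N powr (- (real b * w))" for w
      using x0 N by (simp add: z_def powr_divide powr_realpow[symmetric] powr_powr powr_minus_divide)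
    \<comment> \<open>\<open>T1\<close> collects the errors of the inner sums, \<open>T2\<close> is
      the error of the corrected partial sum of \<open>zeta (b / a)\<close>, \<open>T3\<close> the
      distance of the remainder from its limit, and \<open>T4\<close> the loss from rounding
      \<open>(x / j) powr r\<close> down.\<close>
    define T1 where "T1 = (\<Sum>m\<in>{1..N}. Delta_u k a c (x / real m ^ b))"
    define T2 where "T2 = of_real (\<Sum>m\<in>{1..N}. real m powr (-q)) + of_real (real N powr (1 - q) / (q - 1)) - Z"
    define T3 where "T3 = remainder s z - \<kappa>"
    define T4 where "T4 = (\<Sum>j\<in>{1..nat \<lfloor>z\<rfloor>}. of_real ((x / real j) powr r - real (nat \<lfloor>(x / real j) powr r\<rfloor>)) * u j)"
    have m1: "x / real m ^ b \<ge> 1" if "m \<in> {1..N}" for m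
    proof -
      have "real m ^ b \<le> real N ^ b" using that by (intro power_mono) auto
      thus ?thesis using that xN by simp
    qed
    have m_powr: "(x / real m ^ b) powr w = x powr w * real m powr (- (real b * w))" if "m \<in> {1..N}" for w m
      using x0 that by (simp add: powr_divide powr_realpow[symmetric] powr_powr powr_minus_divide)
    have 1: "(\<Sum>m\<in>{1..N}. \<Sum>j\<in>{1..nat \<lfloor>x / real m ^ b\<rfloor>}. u j)
       = T1 + A * of_real (x powr (1 / real a)) * of_real (\<Sum>m\<in>{1..N}. real m powr (-q))"
    proof -
      have "(\<Sum>m\<in>{1..N}. \<Sum>j\<in>{1..nat \<lfloor>x / real m ^ b\<rfloor>}. u j)
        = (\<Sum>m\<in>{1..N}. Delta_u k a c (x / real m ^ b)
            + A * of_real (x powr (1 / real a)) * of_real (real m powr (-q)))"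
        by (intro sum.cong refl) (simp add: Delta_u_def u_def A_def m_powr q_def)
      thus ?thesis by (simp add: T1_def sum.distrib sum_distrib_left)
    qed
    have 2: "(\<Sum>j\<in>{1..nat \<lfloor>z\<rfloor>}. (of_nat (nat \<lfloor>(x / real j) powr r\<rfloor>) - of_nat N) * u j)
       = of_real (x powr r) * (T3 + \<kappa>)
         + A * of_real (x powr (1 / real a)) * of_real (real N powr (1 - q) / (q - 1)) - T4"
    proof -
      \<comment> \<open>Since \<open>z = x / N ^ b\<close> and \<open>r = 1 / b\<close>, the weight
        \<open>(x / j) powr r - N\<close> becomes \<open>x powr r\<close> times the weight occurring
        in \<open>remainder\<close>.\<close>
      have xz: "x powr r * z powr (- r) = real N"
        using x0 N pos by (simp add: z_powr r_def powr_minus)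
      have "(\<Sum>j\<in>{1..nat \<lfloor>z\<rfloor>}. (of_nat (nat \<lfloor>(x / real j) powr r\<rfloor>) - of_nat N) * u j) + T4
        = (\<Sum>j\<in>{1..nat \<lfloor>z\<rfloor>}. of_real ((x / real j) powr r - real N) * u j)"
        unfolding T4_def sum.distrib[symmetric] by (intro sum.cong) (simp_all add: algebra_simps)
      also have "\<dots> = of_real (x powr r) * (\<Sum>j\<in>{1..nat \<lfloor>z\<rfloor>}. u j * (of_nat j powr (-s) - of_real z powr (-s)))"
        unfolding sum_distrib_left
      proof (rule sum.cong)
        fix j assume j: "j \<in> {1..nat \<lfloor>z\<rfloor>}"
        have "of_nat j powr (-s) = complex_of_real (real j powr (-r))"
          using powr_of_real[of "real j" "-r"] by (simp add: s_def)
        moreover have "of_real z powr (-s) = complex_of_real (z powr (-r))"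
          using powr_of_real[of z "-r"] z1 by (simp add: s_def)
        moreover have "(x / real j) powr r = x powr r * real j powr (-r)"
          using x0 j by (simp add: powr_divide powr_minus_divide)
        hence "(x / real j) powr r - real N = x powr r * (real j powr (-r) - z powr (-r))"
          by (simp only: xz right_diff_distrib)
        ultimately show "of_real ((x / real j) powr r - real N) * u j
            = of_real (x powr r) * (u j * (of_nat j powr (-s) - of_real z powr (-s)))"
          by simp
      qed simp
      also have "(\<Sum>j\<in>{1..nat \<lfloor>z\<rfloor>}. u j * (of_nat j powr (-s) - of_real z powr (-s)))
          = T3 + \<kappa> + A * s / (of_real (1 / real a) - s) * of_real z powr (of_real (1 / real a) - s)"
        by (simp add: T3_def remainder_def)
      \<comment> \<open>The coefficient agrees with that of the tail correction in the partial sum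
        of \<open>zeta (b / a)\<close>, so the two pieces merge in \<open>T2\<close>.\<close>
      also have "A * s / (of_real (1 / real a) - s) = A * of_real (1 / (q - 1))"
      proof -
        have "r / (1 / real a - r) = 1 / (q - 1)"
          using pos ab by (simp add: r_def q_def field_simps)
        hence "s / (of_real (1 / real a) - s) = of_real (1 / (q - 1))"
          unfolding s_def of_real_diff[symmetric] of_real_divide[symmetric] by simp
        thus ?thesis by (simp only: times_divide_eq_right[symmetric])
      qed
      also have "of_real z powr (of_real (1 / real a) - s) = complex_of_real (z powr (1 / real a - r))"
        unfolding s_def of_real_diff[symmetric] using z1 by (intro powr_of_real) simp
      also have "of_real (x powr r) * (T3 + \<kappa> + A * of_real (1 / (q - 1)) * of_real (z powr (1 / real a - r)))
        = of_real (x powr r) * (T3 + \<kappa>) + A * of_real (x powr r * z powr (1 / real a - r)) * of_real (1 / (q - 1))"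
        by (simp add: algebra_simps)
      also have "x powr r * z powr (1 / real a - r) = x powr (1 / real a) * real N powr (1 - q)"
      proof -
        have "- (real b * (1 / real a - r)) = 1 - q" using pos by (simp add: r_def q_def field_simps)
        moreover have "x powr r * x powr (1 / real a - r) = x powr (1 / real a)"
          by (simp add: powr_add[symmetric])
        ultimately show ?thesis by (simp only: z_powr mult.assoc[symmetric])
      qed
      finally show ?thesis by (simp add: algebra_simps)
    qed
    have "(\<Sum>n\<in>{1..nat \<lfloor>x\<rfloor>}. f_k k a b c n)
      = (\<Sum>n\<in>{1..nat \<lfloor>x\<rfloor>}. \<Sum>(m, j)\<in>{(m, j). 0 < m \<and> 0 < j \<and> m ^ b * j = n}. u j)"
      using pos by (simp add: f_k_eq u_def)
    also have "\<dots> = (\<Sum>m\<in>{1..N}. \<Sum>j\<in>{1..nat \<lfloor>x / real m ^ b\<rfloor>}. u j)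
      + (\<Sum>j\<in>{1..nat \<lfloor>z\<rfloor>}. (of_nat (nat \<lfloor>(x / real j) powr r\<rfloor>) - of_nat N) * u j)"
      unfolding z_def r_def by (rule hyperbola_sum[OF pos(2) N xN])
    finally have "Delta_f k a b c x = (T1 + A * of_real (x powr (1 / real a)) * of_real (\<Sum>m\<in>{1..N}. real m powr (-q)))
        + (of_real (x powr r) * (T3 + \<kappa>)
         + A * of_real (x powr (1 / real a)) * of_real (real N powr (1 - q) / (q - 1)) - T4)
        - (Z * A * of_real (x powr (1 / real a)) + \<kappa> * of_real (x powr r))"
      unfolding 1 2 Delta_f_def by (simp add: Z_def A_def \<kappa>_def r_def)
    \<comment> \<open>The \<open>\<kappa>\<close> terms cancel and \<open>Z\<close> is absorbed by
      \<open>T2\<close>; only error terms remain.\<close>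
    also have "\<dots> = T1 + A * of_real (x powr (1 / real a)) * T2 + of_real (x powr r) * T3 - T4"
      unfolding T2_def by (simp only: algebra_simps)
    also have "norm \<dots> \<le> norm T1 + norm (A * of_real (x powr (1 / real a)) * T2) + norm (of_real (x powr r) * T3) + norm T4"
      by (intro order_trans[OF norm_triangle_ineq4] order_trans[OF norm_triangle_ineq] add_mono order_refl)
    also have "\<dots> \<le> C * K1 * e1 + norm A * e2 + K2 * e1 + K0 * e2"
    proof (intro add_mono)
      have "norm T1 \<le> (\<Sum>m\<in>{1..N}. C * x powr \<beta> * real m powr (-p))"
        unfolding T1_def
      proof (intro order_trans[OF norm_sum] sum_mono)
        fix m assume m: "m \<in> {1..N}"
        from u_bound[OF m1[OF m]] show "norm (Delta_u k a c (x / real m ^ b)) \<le> C * x powr \<beta> * real m powr (-p)"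
          by (simp add: m_powr[OF m] p_def)
      qed
      also have "\<dots> = C * x powr \<beta> * (\<Sum>m\<in>{1..N}. real m powr (-p))" by (simp add: sum_distrib_left)
      also have "\<dots> \<le> C * x powr \<beta> * (K1 * real N powr (1 - p))"
        unfolding K1_def using Cnn by (intro mult_left_mono sum_powr_bound p) auto
      finally show "norm T1 \<le> C * K1 * e1" by (simp add: e1_def mult_ac)
      have "of_real q = of_nat b / (of_nat a :: complex)" by (simp add: q_def)
      hence "norm T2 \<le> real N powr (-q)" using zeta_partial_sum[OF q N] by (simp add: T2_def Z_def)
      hence "norm A * x powr (1 / real a) * norm T2 \<le> norm A * x powr (1 / real a) * real N powr (-q)"
        by (intro mult_left_mono) auto
      thus "norm (A * of_real (x powr (1 / real a)) * T2) \<le> norm A * e2"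
        by (simp add: norm_mult e2_def mult_ac)
      have "Re s = r" by (simp add: s_def)
      hence "norm T3 \<le> K2 * z powr (\<beta> - r)"
        using remainder_lim_bound[OF s(1,2) z1] by (simp only: T3_def \<kappa> K2_def)
      hence "x powr r * norm T3 \<le> x powr r * (K2 * z powr (\<beta> - r))" by (intro mult_left_mono) auto
      also have "\<dots> = K2 * e1"
      proof -
        have "- (real b * (\<beta> - r)) = 1 - p" using pos by (simp add: p_def r_def field_simps)
        moreover have "x powr r * x powr (\<beta> - r) = x powr \<beta>"
          by (simp add: powr_add[symmetric])
        ultimately show ?thesis by (simp add: z_powr e1_def)
      qed
      finally show "norm (of_real (x powr r) * T3) \<le> K2 * e1" by (simp add: norm_mult)
      have "norm T4 \<le> (\<Sum>j\<in>{1..nat \<lfloor>z\<rfloor>}. norm (u j))"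
        unfolding T4_def
      proof (intro order_trans[OF norm_sum] sum_mono)
        fix j
        have "\<bar>(x / real j) powr r - real (nat \<lfloor>(x / real j) powr r\<rfloor>)\<bar> \<le> 1"
          using powr_ge_zero[of "x / real j" r] by linarith
        from mult_right_mono[OF this norm_ge_zero[of "u j"]]
        show "norm (of_real ((x / real j) powr r - real (nat \<lfloor>(x / real j) powr r\<rfloor>)) * u j) \<le> norm (u j)"
          unfolding norm_mult norm_of_real by simp
      qed
      also have "\<dots> \<le> K0 * z powr (1 / real a)" by (rule K0[OF z1])
      also have "\<dots> = K0 * e2" by (simp add: z_powr e2_def q_def)
      finally show "norm T4 \<le> K0 * e2" .
    qed
    also have "\<dots> \<le> (C * K1 + norm A + K2 + K0) * (e1 + e2)"
    proof -
      have "e1 \<ge> 0" "e2 \<ge> 0" by (simp_all add: e1_def e2_def)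
      hence "0 \<le> C * K1 * e2" "0 \<le> norm A * e1" "0 \<le> K2 * e2" "0 \<le> K0 * e1"
        using Cnn K0nn K1nn K2nn by simp_all
      thus ?thesis by (simp add: algebra_simps)
    qed
    finally show ?thesis by (simp add: e1_def e2_def)
  qed
  thus ?thesis unfolding p_def q_def by (rule that)
qed

text \<open>On \<open>[1, 2)\<close> only \<open>n = 1\<close> contributes, so the error is bounded,
  while \<open>x powr \<beta>\<close> is at least \<open>2 powr (- \<bar>\<beta>\<bar>)\<close>. The
  hyperbola method evaluates the error at \<open>x / m ^ b\<close>, which may lie in that
  range.\<close>

lemma Delta_u_bound_from_1:
  assumes "a > 0" and bound: "\<And>x. x \<ge> 2 \<Longrightarrow> norm (Delta_u k a c x) \<le> C * x powr \<beta>"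
  obtains C' where "\<And>x. x \<ge> 1 \<Longrightarrow> norm (Delta_u k a c x) \<le> C' * x powr \<beta>"
proof -
  define A where "A = 1 / zeta (of_nat c / of_nat a) ^ k"
  define B where "B = norm (u_k k a c 1) + 2 * norm A"
  have "norm (Delta_u k a c x) \<le> max C (B * 2 powr \<bar>\<beta>\<bar>) * x powr \<beta>" if x: "x \<ge> 1" for x
  proof (cases "x \<ge> 2")
    case True
    note bound[OF True]
    also have "C * x powr \<beta> \<le> max C (B * 2 powr \<bar>\<beta>\<bar>) * x powr \<beta>" by (intro mult_right_mono) auto
    finally show ?thesis .
  next
    case False
    hence fl: "nat \<lfloor>x\<rfloor> = 1" using x by linarith
    have "x powr (1 / real a) \<le> x powr 1" using x assms by (intro powr_mono) auto
    hence le2: "x powr (1 / real a) \<le> 2" using False x by simp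
    have "Delta_u k a c x = u_k k a c 1 - A * of_real (x powr (1 / real a))"
      using fl by (simp add: Delta_u_def A_def)
    also have "norm \<dots> \<le> norm (u_k k a c 1) + norm A * x powr (1 / real a)"
      by (rule order_trans[OF norm_triangle_ineq4]) (simp add: norm_mult)
    also have "\<dots> \<le> B" using mult_left_mono[OF le2, of "norm A"] by (simp add: B_def mult.commute)
    also have "B = B * 1" by simp
    also have "\<dots> \<le> B * (2 powr \<bar>\<beta>\<bar> * x powr \<beta>)"
    proof (rule mult_left_mono)
      have "1 = x powr \<bar>\<beta>\<bar> * x powr (- \<bar>\<beta>\<bar>)" using x by (simp add: powr_minus)
      also have "\<dots> \<le> 2 powr \<bar>\<beta>\<bar> * x powr \<beta>"
        using x False by (intro mult_mono powr_mono2 powr_mono) auto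
      finally show "1 \<le> 2 powr \<bar>\<beta>\<bar> * x powr \<beta>" .
    qed (simp add: B_def)
    also have "\<dots> = B * 2 powr \<bar>\<beta>\<bar> * x powr \<beta>" by simp
    also have "\<dots> \<le> max C (B * 2 powr \<bar>\<beta>\<bar>) * x powr \<beta>" by (intro mult_right_mono) auto
    finally show ?thesis .
  qed
  thus ?thesis by (rule that)
qed

section \<open>Choice of the exponent and of the hyperbola parameter\<close>

theorem corollary1p3:
  fixes a b c k :: nat and \<alpha> :: real
  assumes RH: riemann_hypothesis
    and pos: "0 < a" "0 < b" "0 < c" "0 < k"
    and coprime: "Gcd {a, b, c} = 1"
    and order: "a < c" "c < b" "b < 2 * c"
    and alpha_less: "\<alpha> < 1 / real b"
    and alpha_bound:
      "\<And>\<epsilon>. \<epsilon> > 0 \<Longrightarrow> \<exists>C. \<forall>x\<ge>2. norm (Delta_u k a c x) \<le> C * x powr (\<alpha> + \<epsilon>)"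
  shows "\<forall>\<epsilon>>0. \<exists>C. \<forall>x\<ge>2.
           norm (Delta_f k a b c x) \<le> C * x powr (1 / (real a + real b - real a * real b * \<alpha>) + \<epsilon>)"
proof (intro allI impI)
  fix \<epsilon> :: real assume \<epsilon>: "\<epsilon> > 0"
  define D where "D = (\<lambda>\<beta>. real a + real b - real a * real b * \<beta>)"
  have D_ge: "D \<beta> > real b" if "\<beta> < 1 / real b" for \<beta>
  proof -
    have "real b * \<beta> < 1" using that pos by (simp add: field_simps)
    hence "real a * (real b * \<beta>) < real a * 1" using pos by (intro mult_strict_left_mono) auto
    thus ?thesis by (simp add: D_def mult_ac)
  qed
  \<comment> \<open>The bound for \<open>Delta_u\<close> comes with a positive loss, so it is used
    at some \<open>\<beta> > \<alpha>\<close> close to \<open>\<alpha>\<close>. As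
    \<open>D \<alpha>\<close> is nonzero, \<open>1 / D\<close> is continuous there and the exponent
    grows by less than \<open>\<epsilon>\<close>.\<close>
  have "D \<alpha> \<noteq> 0" using D_ge[OF alpha_less] pos by linarith
  hence "((\<lambda>\<beta>. 1 / D \<beta>) \<longlongrightarrow> 1 / D \<alpha>) (at_right \<alpha>)"
    unfolding D_def by (intro tendsto_intros)
  hence "eventually (\<lambda>\<beta>. 1 / D \<beta> < 1 / D \<alpha> + \<epsilon>) (at_right \<alpha>)"
    using \<epsilon> by (intro order_tendstoD(2)) auto
  moreover have "eventually (\<lambda>\<beta>. \<beta> \<in> {\<alpha><..<1 / real b}) (at_right \<alpha>)"
    using alpha_less by (rule eventually_at_right_real)
  ultimately have "eventually (\<lambda>\<beta>. 1 / D \<beta> < 1 / D \<alpha> + \<epsilon> \<and> \<beta> \<in> {\<alpha><..<1 / real b}) (at_right \<alpha>)"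
    by (rule eventually_conj)
  then obtain \<beta> where \<beta>: "1 / D \<beta> < 1 / D \<alpha> + \<epsilon>" "\<alpha> < \<beta>" "\<beta> < 1 / real b"
    using eventually_happens'[of "at_right \<alpha>"] by auto
  obtain C where "\<And>x. x \<ge> 2 \<Longrightarrow> norm (Delta_u k a c x) \<le> C * x powr \<beta>"
    using alpha_bound[of "\<beta> - \<alpha>"] \<beta> by auto
  then obtain C' where "\<And>x. x \<ge> 1 \<Longrightarrow> norm (Delta_u k a c x) \<le> C' * x powr \<beta>"
    using Delta_u_bound_from_1[OF pos(1)] by blast
  from Delta_f_bound[OF RH pos(1-3) order \<beta>(3) this] obtain K where K:
    "\<And>x N. N > 0 \<Longrightarrow> real N ^ b \<le> x \<Longrightarrow> norm (Delta_f k a b c x) \<le>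
       K * (x powr \<beta> * real N powr (1 - real b * \<beta>) + x powr (1 / real a) * real N powr (- (real b / real a)))"
    by blast
  have D: "D \<beta> > real b" "D \<beta> > 0" using D_ge[OF \<beta>(3)] pos by simp_all
  have b\<beta>: "real b * \<beta> < 1" using \<beta> pos by (simp add: field_simps)
  have "1 / real b < 1 / real a" using order pos by (simp add: field_simps)
  hence "\<beta> < 1 / real a" using \<beta> by linarith
  hence a\<beta>: "real a * \<beta> < 1" using pos by (simp add: field_simps)
  define q where "q = real b / real a"
  \<comment> \<open>with \<open>N = x powr \<theta>\<close> both error terms become \<open>x powr (1 / D \<beta>)\<close>\<close>
  define \<theta> where "\<theta> = (1 - real a * \<beta>) / D \<beta>"
  have \<theta>: "\<theta> > 0" "\<theta> * real b \<le> 1" "\<beta> + \<theta> * (1 - real b * \<beta>) = 1 / D \<beta>" "1 / real a - \<theta> * q = 1 / D \<beta>"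
  proof -
    show "\<theta> > 0" using a\<beta> D by (simp add: \<theta>_def)
    \<comment> \<open>This amounts to
      \<open>b - a * b * \<beta> \<le> a + b - a * b * \<beta>\<close>; it secures
      \<open>N ^ b \<le> x\<close>.\<close>
    show "\<theta> * real b \<le> 1" using D pos by (simp add: \<theta>_def D_def field_simps)
    have "\<beta> * D \<beta> + (1 - real a * \<beta>) * (1 - real b * \<beta>) = 1" by (simp add: D_def algebra_simps)
    thus "\<beta> + \<theta> * (1 - real b * \<beta>) = 1 / D \<beta>" using D by (simp add: \<theta>_def field_simps)
    have "D \<beta> - (1 - real a * \<beta>) * real b = real a" by (simp add: D_def algebra_simps)
    thus "1 / real a - \<theta> * q = 1 / D \<beta>" using D pos by (simp add: \<theta>_def q_def field_simps)
  qed
  have "norm (Delta_f k a b c x) \<le> \<bar>K\<bar> * (1 + 2 powr q) * x powr (1 / D \<alpha> + \<epsilon>)" if x: "x \<ge> 2" for x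
  proof -
    define N where "N = nat \<lfloor>x powr \<theta>\<rfloor>"
    have "x powr \<theta> \<ge> 1" using x \<theta> by (intro ge_one_powr_ge_zero) auto
    hence "\<lfloor>x powr \<theta>\<rfloor> \<ge> 1" by simp
    \<comment> \<open>Rounding down a number that is at least 1 loses at most half of it; the
      resulting lower bound costs the factor \<open>2 powr q\<close> below.\<close>
    hence N: "N > 0" "real N \<le> x powr \<theta>" "x powr \<theta> / 2 \<le> real N" unfolding N_def by linarith+
    have "real N ^ b \<le> (x powr \<theta>) ^ b" using N by (intro power_mono) auto
    also have "\<dots> = x powr (\<theta> * real b)" using x by (simp add: powr_realpow[symmetric] powr_powr)
    also have "\<dots> \<le> x powr 1" using x \<theta> by (intro powr_mono) auto
    finally have "real N ^ b \<le> x" using x by simp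
    note K[OF N(1) this]
    \<comment> \<open>The exponent of \<open>N\<close> is positive in the first term and negative in
      the second, so the upper bound for \<open>N\<close> serves the one and the lower bound the
      other. The sign of \<open>K\<close> is unknown, hence \<open>\<bar>K\<bar>\<close>.\<close>
    also have "K * (x powr \<beta> * real N powr (1 - real b * \<beta>) + x powr (1 / real a) * real N powr (- (real b / real a)))
      \<le> \<bar>K\<bar> * (x powr \<beta> * (x powr \<theta>) powr (1 - real b * \<beta>) + x powr (1 / real a) * (x powr \<theta> / 2) powr (- q))"
      unfolding q_def using b\<beta> N x pos
      by (intro mult_mono add_mono mult_left_mono powr_mono2 powr_mono2') auto
    also have "x powr \<beta> * (x powr \<theta>) powr (1 - real b * \<beta>) = x powr (1 / D \<beta>)"
      by (simp only: powr_powr powr_add[symmetric] \<theta>)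
    also have "x powr (1 / real a) * (x powr \<theta> / 2) powr (- q) = 2 powr q * x powr (1 / D \<beta>)"
    proof -
      have "(x powr \<theta> / 2) powr (- q) = (x powr \<theta>) powr (- q) / 2 powr (- q)"
        by (rule powr_divide)
      also have "\<dots> = 2 powr q * x powr (- (\<theta> * q))"
        by (simp add: powr_powr powr_minus_divide[of 2 q])
      finally have "(x powr \<theta> / 2) powr (- q) = 2 powr q * x powr (- (\<theta> * q))" .
      moreover have "x powr (1 / real a) * x powr (- (\<theta> * q)) = x powr (1 / D \<beta>)"
        by (simp only: powr_add[symmetric] \<theta>(4)[symmetric]) simp
      ultimately show ?thesis by simp
    qed
    also have "\<bar>K\<bar> * (x powr (1 / D \<beta>) + 2 powr q * x powr (1 / D \<beta>)) = \<bar>K\<bar> * (1 + 2 powr q) * x powr (1 / D \<beta>)"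
      by (simp add: algebra_simps)
    also have "\<dots> \<le> \<bar>K\<bar> * (1 + 2 powr q) * x powr (1 / D \<alpha> + \<epsilon>)"
      using \<beta> x by (intro mult_left_mono powr_mono mult_nonneg_nonneg add_nonneg_nonneg) auto
    finally show ?thesis .
  qed
  thus "\<exists>C. \<forall>x\<ge>2. norm (Delta_f k a b c x) \<le> C * x powr (1 / (real a + real b - real a * real b * \<alpha>) + \<epsilon>)"
    unfolding D_def by blast
qed

end
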